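(* Let $0<\beta^2<4\pi$, $\nu=\beta^2/(8\pi-\beta^2)\in(0,1)$, $m>0$ and $\alpha=m^2\frac{\pi\nu}{\sin\pi\nu}$. For $n\ge0$ let $f_n^{T}(\theta_1,\dots,\theta_n)$ and $f_n^{\cos\beta\varphi}(\theta_1,\dots,\theta_n)$ denote the $n$-particle form factors (for the fundamental boson of mass $m$, i.e. the lowest breather) of the trace $T^\mu{}_\mu$ of the sine-Gordon energy momentum tensor and of $\mathcal N\cos\beta\varphi$, as defined in the context. Then the trace of the energy momentum tensor fulfills $$T^\mu{}_\mu=-2\,\frac{\alpha}{\beta^2}\Big(1-\frac{\beta^2}{8\pi}\Big)\big(\mathcal N\cos\beta\varphi-1\big)$$ for all matrix elements. That is, for every $n\ge0$, identically as meromorphic functions of $(\theta_1,\dots,\theta_n)\in\mathbb C^n$, $$f_n^{T}(\theta_1,\dots,\theta_n)=-2\,\frac{\alpha}{\beta^2}\Big(1-\frac{\beta^2}{8\pi}\Big)\big(f_n^{\cos\beta\varphi}(\theta_1,\dots,\theta_n)-\delta_{n,0}\big).$$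
   Context: Throughout $\theta_{ij}=\theta_i-\theta_j$ and $\underline\theta=(\theta_1,\dots,\theta_n)$. A particle with rapidity $\theta$ has momentum $p^\pm=p^0\pm p^1=m e^{\pm\theta}$. The form factor $f_n^{\mathcal O}$ of a local operator $\mathcal O$ is defined by $\langle 0|\mathcal O(x)|p_1,\dots,p_n\rangle^{in}=e^{-ix\cdot(p_1+\dots+p_n)}f_n^{\mathcal O}(\underline\theta)$ for $\theta_1>\dots>\theta_n$ and continued meromorphically; a linear operator equation "for all matrix elements" means the corresponding equation between the functions $f_n$ for all $n$ (the identity operator has $f_n=\delta_{n,0}$). Two-particle function. $F(\theta)$ is the meromorphic continuation of $$F(\theta)=N\exp\int_0^\infty\frac{dt}{t}\,\frac{\big(\cosh\frac12 t-\cosh(\frac12+\nu)t\big)\big(1-\cosh t(1-\frac{\theta}{i\pi})\big)}{\cosh\frac12 t\,\sinh t},$$ with the constant $N$ normalized such that $F(\infty)=1$ (limit $\mathrm{Re}\,\theta\to\infty$). With $$Z^\varphi=(1+\nu)\,\frac{\frac{\pi}{2}\nu}{\sin\frac{\pi}{2}\nu}\exp\Big(-\frac1\pi\int_0^{\pi\nu}\frac{t}{\sin t}\,dt\Big)$$ one has $\frac1{F(i\pi)}=Z^\varphi\,\frac{\beta^2}{8\pi\nu}\,\frac{\sin\pi\nu}{\pi\nu}$. General form. For $n\ge1$, $$f_n^{\mathcal O}(\underline\theta)=N_n^{\mathcal O}\,K_n^{\mathcal O}(\underline\theta)\prod_{1\le i<j\le n}F(\theta_{ij}),$$ $$K_n^{\mathcal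 O}(\underline\theta)=\sum_{l_1=0}^1\cdots\sum_{l_n=0}^1(-1)^{l_1+\dots+l_n}\prod_{1\le i<j\le n}\Big(1+(l_i-l_j)\frac{i\sin\pi\nu}{\sinh\theta_{ij}}\Big)\,p_n^{\mathcal O}(\underline\theta,\underline z),\qquad z_i=\theta_i-\tfrac{i\pi}{2}\big(1+(2l_i-1)\nu\big),$$ where the "p-function" $p_n^{\mathcal O}$ encodes the operator. Operators. (1) Exponentials $\mathcal N e^{i\gamma\varphi}$, $\gamma\in\mathbb R$ ($\mathcal N$ denotes normal ordering with respect to the physical vacuum): $p_n=\prod_{i=1}^n e^{(2l_i-1)i\pi\nu\gamma/\beta}$, $N_n=\big(\sqrt{Z^\varphi}\,\frac{\beta}{2\pi\nu}\big)^n$ for $n\ge1$, and $f_0=1$. (2) $\mathcal N\cos\beta\varphi$: $f_n^{\cos\beta\varphi}=\frac12\big(f_n^{e^{i\beta\varphi}}+f_n^{e^{-i\beta\varphi}}\big)$. (3) Trace of the energy momentum tensor, $T^\mu{}_\mu=T^{+-}$ in light cone components: for even $n\ge2$ the p-function is $p_n=\sum_{i=1}^n e^{\theta_i}\sum_{i=1}^n e^{-z_i}$ and $$N_n^{T}=N_2^{T}\Big(\frac{2}{\sin\pi\nu\,F(i\pi)}\Big)^{(n-2)/2},\qquad N_2^{T}=\frac{i\,m^2}{2\sin\pi\nu\,\sin\frac{\pi\nu}{2}\,F(i\pi)},$$ while $f_n^{T}=0$ for odd $n$ and for $n=0$. (This normalization corresponds to $\langle p|T^\mu{}_\mu|p\rangle=2m^2$,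 i.e. $f_2^{T}(\theta_1,\theta_2)=2m^2$ at $\theta_{12}=i\pi$.) *)

theory Defs
  imports "HOL-Complex_Analysis.Complex_Analysis"
begin

definition coupling_nu :: "real \<Rightarrow> real" where
  "coupling_nu \<beta> = \<beta>\<^sup>2 / (8 * pi - \<beta>\<^sup>2)"


definition F_exponent :: "real \<Rightarrow> complex \<Rightarrow> complex" where
  "F_exponent \<nu> \<theta> = (LBINT t=0..\<infinity>.
     complex_of_real ((cosh (t / 2) - cosh ((1 / 2 + \<nu>) * t)) / (t * cosh (t / 2) * sinh t))
       * (1 - cosh (complex_of_real t * (1 - \<theta> / (\<i> * complex_of_real pi)))))"

(* The integrand of F_exponent is of order exp (t * (\<bar>1 - Im \<theta> / pi\<bar> - (1 - \<nu>))) / t as t tends to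
   infinity, so for 0 < \<nu> < 1 the integral converges absolutely exactly on this strip,
   which does not contain the real axis. *)
definition F_strip :: "real \<Rightarrow> complex set" where
  "F_strip \<nu> = {\<theta>. pi * \<nu> < Im \<theta> \<and> Im \<theta> < 2 * pi - pi * \<nu>}"

(* The limit Re \<theta> \<longrightarrow> \<infinity> is taken along the horizontal lines of the strip of convergence. *)
definition F_norm :: "real \<Rightarrow> complex" where
  "F_norm \<nu> = (THE N. \<forall>y. pi * \<nu> < y \<and> y < 2 * pi - pi * \<nu> \<longrightarrow>
      ((\<lambda>x. N * exp (F_exponent \<nu> (Complex x y))) \<longlongrightarrow> 1) at_top)"

(* Outside the strip F is the meromorphic continuation to the whole plane. It is unique by the
   identity theorem, since nicely_meromorphic_on fixes the values at removable singularities
   (the limit) and at poles (0). *)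
definition F_two_particle :: "real \<Rightarrow> complex \<Rightarrow> complex" where
  "F_two_particle \<nu> \<theta> =
     (if \<theta> \<in> F_strip \<nu> then F_norm \<nu> * exp (F_exponent \<nu> \<theta>)
      else (THE G. G nicely_meromorphic_on UNIV \<and>
              (\<forall>\<zeta>\<in>F_strip \<nu>. G \<zeta> = F_norm \<nu> * exp (F_exponent \<nu> \<zeta>))) \<theta>)"

definition Z_phi :: "real \<Rightarrow> real" where
  "Z_phi \<nu> = (1 + \<nu>) * ((pi / 2 * \<nu>) / sin (pi / 2 * \<nu>))
             * exp (- (1 / pi) * (LBINT t=0..pi * \<nu>. t / sin t))"


(* Rapidities are \<theta> 1, ..., \<theta> n; the other values of \<theta> are irrelevant. A p-function takes n, \<theta> and
   the summation indices l; the dependence on z is through z_shift. *)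
type_synonym p_function = "nat \<Rightarrow> (nat \<Rightarrow> complex) \<Rightarrow> (nat \<Rightarrow> nat) \<Rightarrow> complex"

type_synonym form_factors = "nat \<Rightarrow> (nat \<Rightarrow> complex) \<Rightarrow> complex"

definition z_shift :: "real \<Rightarrow> (nat \<Rightarrow> complex) \<Rightarrow> (nat \<Rightarrow> nat) \<Rightarrow> nat \<Rightarrow> complex" where
  "z_shift \<nu> \<theta> l i =
     \<theta> i - \<i> * complex_of_real pi / 2 * (1 + (2 * of_nat (l i) - 1) * complex_of_real \<nu>)"

definition K_function :: "real \<Rightarrow> p_function \<Rightarrow> form_factors" where
  "K_function \<nu> p n \<theta> =
     (\<Sum>l \<in> {1..n} \<rightarrow>\<^sub>E {0, 1}.
        (-1) ^ (\<Sum>i=1..n. l i)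
        * (\<Prod>j=1..n. \<Prod>i=1..<j.
             1 + (of_nat (l i) - of_nat (l j)) * (\<i> * complex_of_real (sin (pi * \<nu>)) / sinh (\<theta> i - \<theta> j)))
        * p n \<theta> l)"

definition ff_general :: "real \<Rightarrow> (nat \<Rightarrow> complex) \<Rightarrow> p_function \<Rightarrow> form_factors" where
  "ff_general \<nu> N p n \<theta> =
     N n * K_function \<nu> p n \<theta> * (\<Prod>j=1..n. \<Prod>i=1..<j. F_two_particle \<nu> (\<theta> i - \<theta> j))"


definition p_exp :: "real \<Rightarrow> real \<Rightarrow> p_function" where
  "p_exp \<beta> \<gamma> n \<theta> l =
     (\<Prod>i=1..n. exp ((2 * of_nat (l i) - 1) * \<i> * complex_of_real (pi * coupling_nu \<beta> * \<gamma> / \<beta>)))"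

definition N_exp :: "real \<Rightarrow> nat \<Rightarrow> complex" where
  "N_exp \<beta> n = complex_of_real
     ((sqrt (Z_phi (coupling_nu \<beta>)) * (\<beta> / (2 * pi * coupling_nu \<beta>))) ^ n)"

definition ff_exp :: "real \<Rightarrow> real \<Rightarrow> form_factors" where
  "ff_exp \<beta> \<gamma> n \<theta> =
     (if n = 0 then 1 else ff_general (coupling_nu \<beta>) (N_exp \<beta>) (p_exp \<beta> \<gamma>) n \<theta>)"

definition ff_cos :: "real \<Rightarrow> form_factors" where
  "ff_cos \<beta> n \<theta> = 1 / 2 * (ff_exp \<beta> \<beta> n \<theta> + ff_exp \<beta> (- \<beta>) n \<theta>)"

definition p_trace :: "real \<Rightarrow> p_function" where
  "p_trace \<nu> n \<theta> l = (\<Sum>i=1..n. exp (\<theta> i)) * (\<Sum>i=1..n. exp (- z_shift \<nu> \<theta> l i))"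

definition N_trace_2 :: "real \<Rightarrow> real \<Rightarrow> complex" where
  "N_trace_2 \<nu> m =
     \<i> * complex_of_real (m\<^sup>2)
       / (2 * complex_of_real (sin (pi * \<nu>)) * complex_of_real (sin (pi * \<nu> / 2))
            * F_two_particle \<nu> (\<i> * complex_of_real pi))"

(* used for even n \<ge> 2 only *)
definition N_trace :: "real \<Rightarrow> real \<Rightarrow> nat \<Rightarrow> complex" where
  "N_trace \<nu> m n =
     N_trace_2 \<nu> m
       * (2 / (complex_of_real (sin (pi * \<nu>)) * F_two_particle \<nu> (\<i> * complex_of_real pi)))
           ^ ((n - 2) div 2)"

definition ff_trace :: "real \<Rightarrow> real \<Rightarrow> form_factors" where
  "ff_trace \<beta> m n \<theta> =
     (if even n \<and> 2 \<le> n
      then ff_general (coupling_nu \<beta>) (N_trace (coupling_nu \<beta>) m) (p_trace (coupling_nu \<beta>)) n \<theta>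
      else 0)"

definition ff_identity :: form_factors where
  "ff_identity n \<theta> = (if n = 0 then 1 else 0)"

end

(* Put x_i = exp (theta_i), a = 2 i sin (pi nu) and q = exp (i pi nu). Both K-functions are sums over
   the sets S of indices with l_i = 1, with the common weight
   prod (i in S, j not in S) (1 + a x_i x_j / (x_i^2 - x_j^2)). As functions of one variable x_k these
   sums are rational with at most simple poles at x_k = x_j, 0, - x_j. The poles at x_k = x_j cancel
   by symmetry, and the residue at x_k = - x_j is a multiple of the same expression without the
   variables k and j. By induction and Liouville's theorem, for every w with w - 1/w = a,
   K_w = w^(-n) sum_S (-w^2)^|S| weight(S) = a (sum x_i) (sum_S (-1)^|S| weight(S) sum (i in S) 1/x_i). The right-hand side is the
   K-function of the trace up to a factor. Taking w = q and w = - 1/q gives, besides the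
   proportionality, the parity K(-beta) = (-1)^n K(beta), hence the vanishing for odd n.

   The normalizations agree because of the value of F(i pi). There the exponent vanishes, so
   F(i pi) = N, and N is fixed by the Riemann-Lebesgue lemma. Writing the resulting integral as an
   integral over nu and exchanging the two integrations leaves integrals that are evaluated by
   Euler's Beta function and by the partial fraction expansion of the tangent. *)

theory Submission
  imports Defs
begin

text \<open>The induction closes because a pair x_k = -x_j drops out of the total of all variables:
  the residue there carries the total of the remaining variables, as the claim for two variables
  fewer does. For the empty set that claim fails (\<open>exp_sum\<close> is 1,
  \<open>inv_sum\<close> is 0), so poles that leave no variables need a cancellation of their own.
  The obstacle is infinity. The factor sum x_i grows linearly, so the difference of the two sides
  has no evident limit. Dividing it by x_k makes infinity harmless and moves the difficulty to x_k =
  0, where the term 1/x_k of \<open>inv_sum\<close> calls for a first-order expansion of the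
  weights. Both sides carry the same product of two-particle functions, so of F only F(i pi) has to
  be computed, and i pi lies in the strip of convergence. The factor 1/t in the kernel is what
  blocks a direct evaluation; differentiating in \<nu> removes it. The resulting integrands have one
  sign, so the exchange of integrals is Tonelli's theorem for nonnegative integrals, and finiteness
  is checked once, by an exponential bound.\<close>

section \<open>Sums over subsets with two-particle weights\<close>

text \<open>Liouville's theorem after Riemann's theorem has removed the singularities one at a time.
  The limit hypothesis is the form in which simple poles with vanishing residue arise below. Values
  of \<open>f\<close> on \<open>Z\<close> are left arbitrary, since division by zero produces junk
  there.\<close>

lemma holomorphic_eq_0_if_removable:
  fixes f :: "complex \<Rightarrow> complex"
  assumes "finite Z" and "f holomorphic_on - Z"
    and "\<And>\<zeta>. \<zeta> \<in> Z \<Longrightarrow> ((\<lambda>t. (t - \<zeta>) * f t) \<longlongrightarrow> 0) (at \<zeta>)"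
    and "(f \<longlongrightarrow> 0) at_infinity" and "t \<notin> Z"
  shows "f t = 0"
  using assms
proof (induction Z arbitrary: f rule: finite_induct)
  case empty
  then show ?case using Liouville_weak_0[of f t] by simp
next
  case (insert \<xi> Z)
  have op: "open (- Z)" using insert.hyps by (simp add: finite_imp_closed open_Compl)
  have "f holomorphic_on - Z - {\<xi>}"
    using insert.prems(1) by (simp add: Compl_insert)
  moreover have "\<xi> \<in> interior (- Z)" using op insert.hyps by (simp add: interior_open)
  ultimately obtain g where g: "g holomorphic_on - Z" "\<And>z. z \<in> - Z - {\<xi>} \<Longrightarrow> g z = f z"
    using holomorphic_on_extend_lim[of f "- Z" \<xi>] insert.prems(2)[of \<xi>] by blast
  have lim: "((\<lambda>t. (t - \<zeta>) * g t) \<longlongrightarrow> 0) (at \<zeta>)" if "\<zeta> \<in> Z" for \<zeta>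
  proof (rule Lim_transform_eventually[OF insert.prems(2)])
    have "open (- (insert \<xi> Z - {\<zeta>}))"
      using insert.hyps by (intro open_Compl finite_imp_closed) auto
    then have "\<forall>\<^sub>F t in at \<zeta>. t \<in> - (insert \<xi> Z - {\<zeta>}) - {\<zeta>}"
      by (rule eventually_at_in_open) auto
    then show "\<forall>\<^sub>F t in at \<zeta>. (t - \<zeta>) * f t = (t - \<zeta>) * g t"
      by eventually_elim (use g in auto)
  qed (use that in auto)
  have inf: "(g \<longlongrightarrow> 0) at_infinity"
  proof (rule Lim_transform_eventually[OF insert.prems(3)])
    have "bounded (insert \<xi> Z)" using insert.hyps by (simp add: finite_imp_bounded)
    then obtain B where B: "\<And>z. z \<in> insert \<xi> Z \<Longrightarrow> norm z \<le> B" by (auto simp: bounded_iff)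
    have "f z = g z" if "norm z \<ge> B + 1" for z
    proof -
      have "z \<notin> insert \<xi> Z" using B[of z] that by fastforce
      then show ?thesis using g(2)[of z] by auto
    qed
    then show "\<forall>\<^sub>F t in at_infinity. f t = g t"
      unfolding eventually_at_infinity by blast
  qed
  have "g t = 0" using insert.IH[OF g(1) lim inf] insert.prems by auto
  then show ?case using g(2)[of t] insert.prems by auto
qed

section \<open>Subset sums and their dependence on one or two variables\<close>

text \<open>The factor of the K-functions for \<open>l\<^sub>i = 1\<close>, \<open>l\<^sub>j = 0\<close> in the variables \<open>y = exp \<theta>\<^sub>i\<close>, \<open>z = exp \<theta>\<^sub>j\<close>;
  exchanging \<open>y\<close> and \<open>z\<close> gives the factor for \<open>l\<^sub>i = 0\<close>, \<open>l\<^sub>j = 1\<close>.\<close>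

definition scat :: "complex \<Rightarrow> complex \<Rightarrow> complex \<Rightarrow> complex" where
  "scat a y z = 1 + a * y * z / (y\<^sup>2 - z\<^sup>2)"

definition cut_weight :: "complex \<Rightarrow> (nat \<Rightarrow> complex) \<Rightarrow> nat set \<Rightarrow> nat set \<Rightarrow> complex" where
  "cut_weight a x A S = (\<Prod>i\<in>S. \<Prod>j\<in>A - S. scat a (x i) (x j))"

text \<open>K_w of the overview. Apart from the sign, the powers of \<open>w\<close> amount to a
  factor \<open>w\<close> for each element of \<open>S\<close> and \<open>1 / w\<close> for each
  other one, which is the p-function of an exponential. An arbitrary index set \<open>A\<close> lets
  the induction delete any elements.\<close>

definition exp_sum :: "complex \<Rightarrow> (nat \<Rightarrow> complex) \<Rightarrow> nat set \<Rightarrow> complex \<Rightarrow> complex" where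
  "exp_sum a x A w = (\<Sum>S\<in>Pow A. (1 / w) ^ card A * (- w\<^sup>2) ^ card S * cut_weight a x A S)"

text \<open>The part of the trace K-function in which the sum of exp(-z_i) really depends on
  \<open>S\<close>.\<close>

definition inv_sum :: "complex \<Rightarrow> (nat \<Rightarrow> complex) \<Rightarrow> nat set \<Rightarrow> complex" where
  "inv_sum a x A = (\<Sum>S\<in>Pow A. (- 1) ^ card S * (\<Sum>i\<in>S. 1 / x i) * cut_weight a x A S)"

text \<open>Distinct squares keep each variable away from both poles x_j and -x_j. For x_i =
  exp(\<theta>_i) this says that all sinh(\<theta>_i - \<theta>_j) are nonzero.\<close>

definition generic :: "(nat \<Rightarrow> complex) \<Rightarrow> nat set \<Rightarrow> bool" where
  "generic x A \<longleftrightarrow> (\<forall>i\<in>A. x i \<noteq> 0) \<and> (\<forall>i\<in>A. \<forall>j\<in>A. i \<noteq> j \<longrightarrow> (x i)\<^sup>2 \<noteq> (x j)\<^sup>2)"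

lemma generic_subset: "generic x A \<Longrightarrow> B \<subseteq> A \<Longrightarrow> generic x B"
  unfolding generic_def by blast

text \<open>Crossing: a shift of one rapidity by i pi exchanges the two factors of a pair. This is
  what lets the residues at -x_j factorize.\<close>

lemma scat_neg1: "scat a (- y) z = scat a z y"
  and scat_neg2: "scat a y (- z) = scat a z y"
proof -
  have "c / (z\<^sup>2 - y\<^sup>2) = - (c / (y\<^sup>2 - z\<^sup>2))" for c
    by (metis minus_diff_eq minus_divide_right)
  then show "scat a (- y) z = scat a z y" "scat a y (- z) = scat a z y"
    by (simp_all add: scat_def mult_ac)
qed

lemma scat_swap: "scat a y z = 2 - scat a z y"
proof -
  have "c / (z\<^sup>2 - y\<^sup>2) = - (c / (y\<^sup>2 - z\<^sup>2))" for c
    by (metis minus_diff_eq minus_divide_right)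
  then show ?thesis by (simp add: scat_def mult_ac)
qed

lemma sum_Pow_insert:
  assumes "finite B" "k \<notin> B"
  shows "(\<Sum>S\<in>Pow (insert k B). f S) = (\<Sum>T\<in>Pow B. f T + f (insert k T))"
proof -
  have "inj_on (insert k) (Pow B)" using assms(2) by (auto simp: inj_on_def)
  moreover have "Pow B \<inter> insert k ` Pow B = {}" using assms(2) by auto
  ultimately show ?thesis
    using assms(1) unfolding Pow_insert
    by (simp add: sum.union_disjoint sum.reindex sum.distrib)
qed

lemma card_insert_subset: "finite B \<Longrightarrow> k \<notin> B \<Longrightarrow> T \<subseteq> B \<Longrightarrow> card (insert k T) = Suc (card T)"
  by (meson card_insert_disjoint finite_subset subsetD)

lemma cut_weight_cong: "(\<And>i. i \<in> A \<Longrightarrow> x i = y i) \<Longrightarrow> S \<subseteq> A \<Longrightarrow> cut_weight a x A S = cut_weight a y A S"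
  unfolding cut_weight_def by (intro prod.cong refl) (metis DiffD1 subset_iff)

lemma cut_weight_insert_notin:
  assumes "finite B" "k \<notin> B" "T \<subseteq> B"
  shows "cut_weight a x (insert k B) T = cut_weight a x B T * (\<Prod>i\<in>T. scat a (x i) (x k))"
proof -
  have "insert k B - T = insert k (B - T)" using assms by auto
  then show ?thesis using assms by (simp add: cut_weight_def prod.distrib mult.commute)
qed

lemma cut_weight_insert_in:
  assumes "finite B" "k \<notin> B" "T \<subseteq> B"
  shows "cut_weight a x (insert k B) (insert k T) = cut_weight a x B T * (\<Prod>j\<in>B - T. scat a (x k) (x j))"
proof -
  have "insert k B - insert k T = B - T" "k \<notin> T" "finite T"
    using assms finite_subset by auto
  then show ?thesis by (simp add: cut_weight_def mult.commute)
qed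

text \<open>Splitting the subsets by membership of \<open>k\<close> confines \<open>t\<close> to
  products of single factors; the weights within \<open>B\<close> are constants.\<close>

lemma sum_cut_weight_insert:
  assumes "finite B" "k \<notin> B"
  shows "(\<Sum>S\<in>Pow (insert k B). g S * cut_weight a (x(k := t)) (insert k B) S) =
    (\<Sum>T\<in>Pow B. cut_weight a x B T *
      (g T * (\<Prod>i\<in>T. scat a (x i) t) + g (insert k T) * (\<Prod>j\<in>B - T. scat a t (x j))))"
  unfolding sum_Pow_insert[OF assms]
proof (intro sum.cong refl)
  fix T assume T: "T \<in> Pow B"
  have "cut_weight a (x(k := t)) B T = cut_weight a x B T"
    using assms T by (intro cut_weight_cong) auto
  moreover have "(\<Prod>i\<in>T. scat a ((x(k := t)) i) ((x(k := t)) k)) = (\<Prod>i\<in>T. scat a (x i) t)"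
    using assms T by (intro prod.cong) auto
  moreover have "(\<Prod>j\<in>B - T. scat a ((x(k := t)) k) ((x(k := t)) j)) = (\<Prod>j\<in>B - T. scat a t (x j))"
    using assms by (intro prod.cong) auto
  ultimately show "g T * cut_weight a (x(k := t)) (insert k B) T
      + g (insert k T) * cut_weight a (x(k := t)) (insert k B) (insert k T) =
    cut_weight a x B T *
      (g T * (\<Prod>i\<in>T. scat a (x i) t) + g (insert k T) * (\<Prod>j\<in>B - T. scat a t (x j)))"
    using T by (simp add: cut_weight_insert_notin[OF assms] cut_weight_insert_in[OF assms] algebra_simps)
qed

text \<open>Of the four kinds of subsets, only those containing exactly one of \<open>k\<close> and
  \<open>j\<close> have a factor that is singular at t = x_j or t = -x_j.\<close>

lemma sum_cut_weight_insert2: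
  assumes "finite C" "k \<notin> C" "j \<notin> C" "j \<noteq> k"
  shows "(\<Sum>S\<in>Pow (insert k (insert j C)). g S * cut_weight a (x(k := t)) (insert k (insert j C)) S) =
    (\<Sum>T\<in>Pow C. cut_weight a x C T *
      ((\<Prod>i\<in>T. scat a (x i) (x j)) *
         (g T * (\<Prod>i\<in>T. scat a (x i) t)
          + g (insert k T) * (scat a t (x j) * (\<Prod>i\<in>C - T. scat a t (x i))))
       + (\<Prod>i\<in>C - T. scat a (x j) (x i)) *
         (g (insert j T) * (scat a (x j) t * (\<Prod>i\<in>T. scat a (x i) t))
          + g (insert k (insert j T)) * (\<Prod>i\<in>C - T. scat a t (x i)))))"
proof -
  have B: "finite (insert j C)" "k \<notin> insert j C" using assms by auto
  show ?thesis
    unfolding sum_cut_weight_insert[OF B] sum_Pow_insert[OF assms(1,3)]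
  proof (intro sum.cong refl, goal_cases)
    case (1 T)
    then have T: "T \<subseteq> C" "finite T" "j \<notin> T" using assms finite_subset by auto
    have [simp]: "insert j C - T = insert j (C - T)" "insert j C - insert j T = C - T"
      using T assms by auto
    show ?case
      using T assms
      by (simp add: cut_weight_insert_notin cut_weight_insert_in) (simp add: algebra_simps)
  qed
qed

section \<open>Residues and behaviour at infinity\<close>

text \<open>For either sign of z the denominator is (t - z)(t + z), and z cancels in a z y / (2 z).
  Hence the residue is the same at y and at -y; exchanging the arguments reverses its sign.\<close>

lemma tendsto_scat_pole:
  assumes "y \<noteq> 0" "z = y \<or> z = - y"
  shows "((\<lambda>t. (t - z) * scat a t y) \<longlongrightarrow> a * y / 2) (at z)"
    and "((\<lambda>t. (t - z) * scat a y t) \<longlongrightarrow> - (a * y / 2)) (at z)"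
proof -
  have ev: "\<forall>\<^sub>F t in at z. t \<noteq> z" by (simp add: eventually_at_filter)
  have z: "z \<noteq> 0" and yz: "y\<^sup>2 = z\<^sup>2" using assms by auto
  have "((\<lambda>t. t - z + a * t * y / (t + z)) \<longlongrightarrow> z - z + a * z * y / (z + z)) (at z)"
    using z by (intro tendsto_intros) auto
  moreover have "z - z + a * z * y / (z + z) = a * y / 2" using z by simp
  ultimately have lim: "((\<lambda>t. t - z + a * t * y / (t + z)) \<longlongrightarrow> a * y / 2) (at z)"
    by (simp only:)
  have "\<forall>\<^sub>F t in at z. t - z + a * t * y / (t + z) = (t - z) * scat a t y"
    using ev
  proof eventually_elim
    case (elim t)
    have "t\<^sup>2 - y\<^sup>2 = (t - z) * (t + z)" unfolding yz by (simp add: power2_eq_square algebra_simps)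
    moreover have "(t - z) * (c / ((t - z) * (t + z))) = c / (t + z)" for c
      using elim by simp
    ultimately show ?case by (simp only: scat_def distrib_left mult_1_right)
  qed
  with lim show lim: "((\<lambda>t. (t - z) * scat a t y) \<longlongrightarrow> a * y / 2) (at z)"
    by (rule Lim_transform_eventually)
  have "((\<lambda>t. 2 * (t - z) - (t - z) * scat a t y) \<longlongrightarrow> 2 * (z - z) - a * y / 2) (at z)"
    by (intro tendsto_intros lim)
  moreover have "2 * (t - z) - (t - z) * scat a t y = (t - z) * scat a y t" for t
    by (simp add: scat_swap[of a y t] algebra_simps)
  ultimately show "((\<lambda>t. (t - z) * scat a y t) \<longlongrightarrow> - (a * y / 2)) (at z)" by simp
qed

lemma tendsto_scat [tendsto_intros]:
  assumes "(f \<longlongrightarrow> y) F" "(h \<longlongrightarrow> z) F" "y\<^sup>2 \<noteq> z\<^sup>2"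
  shows "((\<lambda>t. scat a (f t) (h t)) \<longlongrightarrow> scat a y z) F"
  unfolding scat_def using assms by (intro tendsto_intros) auto

lemma holomorphic_scat [holomorphic_intros]:
  assumes "f holomorphic_on S" "h holomorphic_on S" "\<And>t. t \<in> S \<Longrightarrow> (f t)\<^sup>2 \<noteq> (h t)\<^sup>2"
  shows "(\<lambda>t. scat a (f t) (h t)) holomorphic_on S"
  unfolding scat_def using assms by (intro holomorphic_intros) auto

lemma tendsto_scat_at_infinity:
  shows "((\<lambda>t. scat a t y) \<longlongrightarrow> 1) at_infinity" and "((\<lambda>t. scat a y t) \<longlongrightarrow> 1) at_infinity"
proof -
  have inv: "((\<lambda>t. inverse t) \<longlongrightarrow> (0::complex)) at_infinity" by (rule tendsto_inverse_0)
  have ev: "\<forall>\<^sub>F t in at_infinity. t \<noteq> (0::complex)" by (rule eventually_not_equal_at_infinity)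
  have "((\<lambda>t. 1 + a * y * inverse t / (1 - (y * inverse t)\<^sup>2)) \<longlongrightarrow> 1 + a * y * 0 / (1 - (y * 0)\<^sup>2)) at_infinity"
    by (intro tendsto_intros inv) auto
  moreover have "\<forall>\<^sub>F t in at_infinity. 1 + a * y * inverse t / (1 - (y * inverse t)\<^sup>2) = scat a t y"
    using ev
  proof eventually_elim
    case (elim t)
    have "t\<^sup>2 - y\<^sup>2 = t\<^sup>2 * (1 - (y * inverse t)\<^sup>2)"
      using elim by (simp add: field_simps power2_eq_square)
    then show ?case using elim by (simp add: scat_def power2_eq_square field_simps)
  qed
  ultimately show lim: "((\<lambda>t. scat a t y) \<longlongrightarrow> 1) at_infinity"
    by (auto intro: Lim_transform_eventually)
  show "((\<lambda>t. scat a y t) \<longlongrightarrow> 1) at_infinity"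
    using tendsto_diff[OF tendsto_const[of 2] lim] by (simp add: scat_swap[of a y])
qed

text \<open>Subsets with only \<open>k\<close> and subsets with only \<open>j\<close> contribute
  residues of opposite sign, so a difference of two sums over subsets of \<open>C\<close>
  remains.\<close>

lemma tendsto_pole_sum_cut_weight:
  assumes C: "finite C" "k \<notin> C" "j \<notin> C" "j \<noteq> k"
    and gen: "generic x (insert j C)"
    and z: "z = x j \<or> z = - x j"
    and g: "\<And>S. S \<subseteq> insert k (insert j C) \<Longrightarrow> (g S \<longlongrightarrow> g S z) (at z)"
  shows "((\<lambda>t. (t - z) * (\<Sum>S\<in>Pow (insert k (insert j C)).
             g S t * cut_weight a (x(k := t)) (insert k (insert j C)) S)) \<longlongrightarrow>
     a * x j / 2 * (\<Sum>T\<in>Pow C. cut_weight a x C T *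
       ((\<Prod>i\<in>T. scat a (x i) (x j)) * (\<Prod>i\<in>C - T. scat a z (x i)) * g (insert k T) z
        - (\<Prod>i\<in>C - T. scat a (x j) (x i)) * (\<Prod>i\<in>T. scat a (x i) z) * g (insert j T) z)))
     (at z)"
proof -
  have xj: "x j \<noteq> 0" using gen by (simp add: generic_def)
  have nz: "z\<^sup>2 \<noteq> (x i)\<^sup>2" "(x i)\<^sup>2 \<noteq> z\<^sup>2" if "i \<in> C" for i
  proof -
    have "i \<noteq> j" using that C(3) by auto
    then have "(x i)\<^sup>2 \<noteq> (x j)\<^sup>2" using gen that by (simp add: generic_def)
    then show "z\<^sup>2 \<noteq> (x i)\<^sup>2" "(x i)\<^sup>2 \<noteq> z\<^sup>2" using z by auto
  qed
  have t0: "((\<lambda>t. t - z) \<longlongrightarrow> 0) (at z)"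
    by (simp add: LIM_zero_iff[of "\<lambda>t. t"])
  note pole = tendsto_scat_pole[OF xj z]
  \<comment> \<open>In each term \<open>t - z\<close> is attached to the singular factor if there is
    one; otherwise it sends the term to 0.\<close>
  have "((\<lambda>t. \<Sum>T\<in>Pow C. cut_weight a x C T *
      ((\<Prod>i\<in>T. scat a (x i) (x j)) *
         (g T t * ((t - z) * (\<Prod>i\<in>T. scat a (x i) t))
          + g (insert k T) t * (((t - z) * scat a t (x j)) * (\<Prod>i\<in>C - T. scat a t (x i))))
       + (\<Prod>i\<in>C - T. scat a (x j) (x i)) *
         (g (insert j T) t * (((t - z) * scat a (x j) t) * (\<Prod>i\<in>T. scat a (x i) t))
          + g (insert k (insert j T)) t * ((t - z) * (\<Prod>i\<in>C - T. scat a t (x i))))))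
     \<longlongrightarrow> (\<Sum>T\<in>Pow C. cut_weight a x C T *
      ((\<Prod>i\<in>T. scat a (x i) (x j)) *
         (g T z * (0 * (\<Prod>i\<in>T. scat a (x i) z))
          + g (insert k T) z * ((a * x j / 2) * (\<Prod>i\<in>C - T. scat a z (x i))))
       + (\<Prod>i\<in>C - T. scat a (x j) (x i)) *
         (g (insert j T) z * (- (a * x j / 2) * (\<Prod>i\<in>T. scat a (x i) z))
          + g (insert k (insert j T)) z * (0 * (\<Prod>i\<in>C - T. scat a z (x i))))))) (at z)"
    by (intro tendsto_sum tendsto_mult tendsto_add tendsto_prod tendsto_const t0 pole tendsto_scat
        tendsto_ident_at g) (use nz in auto)
  also have "(\<lambda>t. \<Sum>T\<in>Pow C. cut_weight a x C T *
      ((\<Prod>i\<in>T. scat a (x i) (x j)) *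
         (g T t * ((t - z) * (\<Prod>i\<in>T. scat a (x i) t))
          + g (insert k T) t * (((t - z) * scat a t (x j)) * (\<Prod>i\<in>C - T. scat a t (x i))))
       + (\<Prod>i\<in>C - T. scat a (x j) (x i)) *
         (g (insert j T) t * (((t - z) * scat a (x j) t) * (\<Prod>i\<in>T. scat a (x i) t))
          + g (insert k (insert j T)) t * ((t - z) * (\<Prod>i\<in>C - T. scat a t (x i))))))
    = (\<lambda>t. (t - z) * (\<Sum>S\<in>Pow (insert k (insert j C)).
             g S t * cut_weight a (x(k := t)) (insert k (insert j C)) S))"
    by (simp add: sum_cut_weight_insert2[OF C] sum_distrib_left algebra_simps)
  finally show ?thesis
    by (rule back_subst[where P = "\<lambda>c. (_ \<longlongrightarrow> c) _"])
      (simp add: sum_distrib_left algebra_simps)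
qed

text \<open>The hypotheses \<open>zero\<close> hold by induction on the number of variables.
  For empty \<open>C\<close> the two contributions cancel instead.\<close>

lemma tendsto_pole_sum_cut_weight_0:
  assumes C: "finite C" "k \<notin> C" "j \<notin> C" "j \<noteq> k"
    and gen: "generic x (insert j C)"
    and z: "z = x j \<or> z = - x j"
    and g: "\<And>S. S \<subseteq> insert k (insert j C) \<Longrightarrow> (g S \<longlongrightarrow> g S z) (at z)"
    and eq: "\<And>T. T \<subseteq> C \<Longrightarrow> g (insert k T) (x j) = g (insert j T) (x j)"
    and empty: "C = {} \<Longrightarrow> g {k} (- x j) = g {j} (- x j)"
    and zero: "C \<noteq> {} \<Longrightarrow> (\<Sum>T\<in>Pow C. g (insert k T) (- x j) * cut_weight a x C T) = 0"
      "C \<noteq> {} \<Longrightarrow> (\<Sum>T\<in>Pow C. g (insert j T) (- x j) * cut_weight a x C T) = 0"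
  shows "((\<lambda>t. (t - z) * (\<Sum>S\<in>Pow (insert k (insert j C)).
             g S t * cut_weight a (x(k := t)) (insert k (insert j C)) S)) \<longlongrightarrow> 0) (at z)"
proof -
  have "(\<Sum>T\<in>Pow C. cut_weight a x C T *
       ((\<Prod>i\<in>T. scat a (x i) (x j)) * (\<Prod>i\<in>C - T. scat a z (x i)) * g (insert k T) z
        - (\<Prod>i\<in>C - T. scat a (x j) (x i)) * (\<Prod>i\<in>T. scat a (x i) z) * g (insert j T) z)) = 0"
    (is "?s = 0") using z
  proof
    \<comment> \<open>Here x_k and x_j coincide, so exchanging them changes nothing and each summand
      vanishes by \<open>eq\<close>.\<close>
    assume "z = x j"
    then show ?thesis using eq by (intro sum.neutral) auto
  next
    assume z: "z = - x j"
    \<comment> \<open>By crossing, the products over \<open>T\<close> and \<open>C - T\<close> are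
      products of the same factor and complete to a product over \<open>C\<close>. It does not
      depend on \<open>T\<close> and can be pulled out, which leaves the sums in
      \<open>zero\<close>.\<close>
    have split: "(\<Prod>i\<in>T. f i) * (\<Prod>i\<in>C - T. f i) = (\<Prod>i\<in>C. f i)" if "T \<subseteq> C" for T and f :: "nat \<Rightarrow> complex"
      using prod.subset_diff[OF that C(1), of f] by (simp add: mult.commute)
    have "?s = (\<Sum>T\<in>Pow C. (\<Prod>i\<in>C. scat a (x i) (x j)) * (g (insert k T) z * cut_weight a x C T)
          - (\<Prod>i\<in>C. scat a (x j) (x i)) * (g (insert j T) z * cut_weight a x C T))"
    proof (intro sum.cong refl, goal_cases)
      case (1 T)
      then have T: "T \<subseteq> C" by simp
      show ?case
        unfolding z scat_neg1 scat_neg2 split[OF T, of "\<lambda>i. scat a (x i) (x j)", symmetric]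
          split[OF T, of "\<lambda>i. scat a (x j) (x i)", symmetric]
        by (simp add: algebra_simps)
    qed
    also have "\<dots> = (\<Prod>i\<in>C. scat a (x i) (x j)) * (\<Sum>T\<in>Pow C. g (insert k T) z * cut_weight a x C T)
          - (\<Prod>i\<in>C. scat a (x j) (x i)) * (\<Sum>T\<in>Pow C. g (insert j T) z * cut_weight a x C T)"
      by (simp add: sum_subtractf sum_distrib_left)
    also have "\<dots> = 0"
      using empty zero unfolding z by (cases "C = {}") auto
    finally show ?thesis .
  qed
  note eq0 = this
  show ?thesis
    using tendsto_pole_sum_cut_weight[where a = a and g = g, OF C gen z g] unfolding eq0 by simp
qed

lemma holomorphic_sum_cut_weight:
  assumes "finite B" "k \<notin> B" "\<And>S. S \<subseteq> insert k B \<Longrightarrow> g S holomorphic_on U"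
    and "\<And>t j. t \<in> U \<Longrightarrow> j \<in> B \<Longrightarrow> t \<noteq> x j \<and> t \<noteq> - x j"
  shows "(\<lambda>t. \<Sum>S\<in>Pow (insert k B). g S t * cut_weight a (x(k := t)) (insert k B) S) holomorphic_on U"
proof -
  have "t\<^sup>2 \<noteq> (x j)\<^sup>2" "(x j)\<^sup>2 \<noteq> t\<^sup>2" if "t \<in> U" "j \<in> B" for t j
    using assms(4)[OF that] by (auto simp: power2_eq_iff)
  then show ?thesis
    unfolding sum_cut_weight_insert[OF assms(1,2)]
    by (intro holomorphic_intros assms(3)) auto
qed

lemma tendsto_sum_cut_weight_at_infinity:
  assumes "finite B" "k \<notin> B" "\<And>S. S \<subseteq> insert k B \<Longrightarrow> (g S \<longlongrightarrow> h S) at_infinity"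
  shows "((\<lambda>t. \<Sum>S\<in>Pow (insert k B). g S t * cut_weight a (x(k := t)) (insert k B) S) \<longlongrightarrow>
      (\<Sum>T\<in>Pow B. cut_weight a x B T * (h T + h (insert k T)))) at_infinity"
proof -
  have "((\<lambda>t. \<Sum>S\<in>Pow (insert k B). g S t * cut_weight a (x(k := t)) (insert k B) S) \<longlongrightarrow>
      (\<Sum>T\<in>Pow B. cut_weight a x B T * (h T * (\<Prod>i\<in>T. 1) + h (insert k T) * (\<Prod>i\<in>B - T. 1)))) at_infinity"
    unfolding sum_cut_weight_insert[OF assms(1,2)]
    by (intro tendsto_intros tendsto_scat_at_infinity assms(3)) auto
  then show ?thesis by simp
qed

lemma exp_sum_1: "exp_sum a x A 1 = (\<Sum>S\<in>Pow A. (- 1) ^ card S * cut_weight a x A S)"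
  by (simp add: exp_sum_def)

section \<open>The two identities for subset sums\<close>

text \<open>At infinity the contributions of \<open>T\<close> and \<open>insert k T\<close> cancel
  by sign, and the residues reduce to two variables fewer, hence strong induction. Here
  \<open>a\<close> is unrelated to w = 1. The result disposes of every contribution to
  \<open>inv_sum\<close> or to the trace whose coefficient is independent of
  \<open>S\<close>.\<close>

lemma exp_sum_1_eq_0:
  assumes "finite A" "A \<noteq> {}" "generic x A"
  shows "exp_sum a x A 1 = 0"
  using assms
proof (induction "card A" arbitrary: A rule: less_induct)
  case less
  then obtain k B where A: "A = insert k B" "k \<notin> B" by (meson Set.set_insert ex_in_conv)
  then have B: "finite B" using less.prems by auto
  define f where "f = (\<lambda>t. \<Sum>S\<in>Pow (insert k B). (- 1) ^ card S * cut_weight a (x(k := t)) (insert k B) S)"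
  define Z where "Z = x ` B \<union> (\<lambda>j. - x j) ` B"
  have "f (x k) = 0"
  proof (rule holomorphic_eq_0_if_removable[where f = f and Z = Z])
    show "finite Z" using B by (simp add: Z_def)
    show "f holomorphic_on - Z"
      unfolding f_def by (intro holomorphic_sum_cut_weight B A holomorphic_intros) (auto simp: Z_def)
    show "x k \<notin> Z"
    proof
      assume "x k \<in> Z"
      then obtain j where j: "j \<in> B" "x k = x j \<or> x k = - x j" by (auto simp: Z_def)
      then have "k \<in> A" "j \<in> A" "k \<noteq> j" "(x k)\<^sup>2 = (x j)\<^sup>2" using A by auto
      then show False using less.prems(3) unfolding generic_def by metis
    qed
    show "(f \<longlongrightarrow> 0) at_infinity"
    proof -
      have "(\<Sum>T\<in>Pow B. cut_weight a x B T * ((- 1) ^ card T + (- 1) ^ card (insert k T))) = 0"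
        using card_insert_subset[OF B A(2)] by (intro sum.neutral) simp
      then show ?thesis
        using tendsto_sum_cut_weight_at_infinity[OF B A(2), of "\<lambda>S t. (- 1) ^ card S" "\<lambda>S. (- 1) ^ card S" a x]
        by (simp add: f_def)
    qed
    fix \<zeta> assume "\<zeta> \<in> Z"
    then obtain j where j: "j \<in> B" "\<zeta> = x j \<or> \<zeta> = - x j" by (auto simp: Z_def)
    define C where "C = B - {j}"
    have C: "finite C" "k \<notin> C" "j \<notin> C" "j \<noteq> k" "B = insert j C" using B A j by (auto simp: C_def)
    have sum0: "C \<noteq> {} \<Longrightarrow> (\<Sum>T\<in>Pow C. (- 1) ^ card T * cut_weight a x C T) = 0"
      using less.hyps[of C] C(1-4) generic_subset[OF less.prems(3), of C]
      by (auto simp: exp_sum_1 A(1) C(5) card_insert_if)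
    have cards: "card (insert k T) = Suc (card T)" "card (insert j T) = Suc (card T)" if "T \<in> Pow C" for T
      using that card_insert_subset[OF C(1,2)] card_insert_subset[OF C(1,3)] by auto
    have s: "(\<Sum>T\<in>Pow C. (- 1) ^ card (insert i T) * cut_weight a x C T) = - (\<Sum>T\<in>Pow C. (- 1) ^ card T * cut_weight a x C T)"
      if "i = k \<or> i = j" for i
      unfolding sum_negf[symmetric] by (intro sum.cong refl) (use that cards in auto)
    show "((\<lambda>t. (t - \<zeta>) * f t) \<longlongrightarrow> 0) (at \<zeta>)"
      unfolding f_def C(5)
    proof (rule tendsto_pole_sum_cut_weight_0[where x = x and j = j and z = \<zeta> and g = "\<lambda>S t. (- 1) ^ card S", OF C(1-4) _ j(2)])
      show "generic x (insert j C)" using less.prems(3) A C(5) generic_subset by blast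
      show "(- 1) ^ card (insert k T) = (- 1) ^ card (insert j T)" if "T \<subseteq> C" for T
        using that cards by simp
    qed (use sum0 s in auto)
  qed
  then show ?case using A by (simp add: f_def exp_sum_1)
qed

lemma scat_0 [simp]: "scat a 0 y = 1" "scat a y 0 = 1"
  by (simp_all add: scat_def)

text \<open>To first order \<open>scat a t y\<close> is 1 - a t / y. This order matters because
  \<open>inv_sum\<close> contains 1/x_k, which is 1/t.\<close>

lemma DERIV_prod_scat_0:
  assumes "finite J" "\<And>j. j \<in> J \<Longrightarrow> x j \<noteq> 0"
  shows "((\<lambda>t. \<Prod>j\<in>J. scat a t (x j)) has_field_derivative - a * (\<Sum>j\<in>J. 1 / x j)) (at 0)"
  using assms
proof (induction J rule: finite_induct)
  case (insert j J)
  have "((\<lambda>t. scat a t (x j)) has_field_derivative - a / x j) (at 0)"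
    unfolding scat_def using insert.prems[of j]
    by (auto intro!: derivative_eq_intros simp: field_simps power2_eq_square)
  from DERIV_mult[OF this insert.IH] insert show ?case
    by (simp add: algebra_simps)
qed simp

text \<open>The coefficients at 0 and at -x_j both take this shape, so the remaining sums become
  combinations to which the induction hypothesis and \<open>exp_sum_1_eq_0\<close> apply.\<close>

lemma sum_Pow_cut_weight_linear:
  "(\<Sum>T\<in>Pow C. (u * ((1 / w) ^ card C * (- w\<^sup>2) ^ card T) + v * ((- 1) ^ card T * (\<Sum>i\<in>T. 1 / x i))
       + y * (- 1) ^ card T) * cut_weight a x C T)
   = u * exp_sum a x C w + v * inv_sum a x C + y * exp_sum a x C 1"
  by (simp add: exp_sum_def inv_sum_def sum_distrib_left sum.distrib[symmetric] algebra_simps)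

text \<open>The relation \<open>w - 1 / w = a\<close> is dictated by one variable, where the left
  side is 1/w - w and the right side is -a. It enters again at x_k = 0: there both sides become -a
  times the corresponding sides for the other variables.\<close>

lemma exp_sum_eq_inv_sum:
  assumes "finite A" "A \<noteq> {}" "generic x A" "w \<noteq> 0" "w - 1 / w = a"
  shows "exp_sum a x A w = a * (\<Sum>i\<in>A. x i) * inv_sum a x A"
  using assms(1-3)
proof (induction "card A" arbitrary: A rule: less_induct)
  case less
  then obtain k B where A: "A = insert k B" "k \<notin> B" by (meson Set.set_insert ex_in_conv)
  then have B: "finite B" using less.prems by auto
  have k0: "x k \<noteq> 0" using less.prems(3) A by (auto simp: generic_def)
  have a: "(1 - w\<^sup>2) / w = - a" using assms(4,5) by (simp add: field_simps power2_eq_square)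
  show ?case
  proof (cases "B = {}")
    case True
    then show ?thesis
      using k0 a assms(4) by (simp add: A exp_sum_def inv_sum_def cut_weight_def Pow_insert field_simps)
  next
    case False
    define p where "p = (\<Sum>i\<in>B. x i)"
    define \<sigma> where "\<sigma> S = (\<Sum>i\<in>S. 1 / x i)" for S
    \<comment> \<open>\<open>f t\<close> is the difference of the two sides at \<open>x k = t\<close>, divided by \<open>t\<close>: that makes it vanish at
      infinity, and it has no pole at 0 because the difference vanishes there by induction.\<close>
    define g where "g S t = inverse t * ((1 / w) ^ card A * (- w\<^sup>2) ^ card S)
       - a * (1 + p * inverse t) * ((- 1) ^ card S * (\<sigma> (S - {k}) + (if k \<in> S then inverse t else 0)))" for S t
    define f where "f = (\<lambda>t. \<Sum>S\<in>Pow (insert k B). g S t * cut_weight a (x(k := t)) (insert k B) S)"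
    define Z where "Z = insert 0 (x ` B \<union> (\<lambda>j. - x j) ` B)"
    have g_notin: "g T t = inverse t * ((1 / w) ^ card A * (- w\<^sup>2) ^ card T)
       - a * (1 + p * inverse t) * ((- 1) ^ card T * \<sigma> T)" if "T \<subseteq> B" for T t
    proof -
      have "k \<notin> T" "T - {k} = T" using that A by auto
      then show ?thesis by (simp add: g_def)
    qed
    have g_in: "g (insert k T) t = - inverse t * ((1 / w) ^ card A * w\<^sup>2 * (- w\<^sup>2) ^ card T)
       + a * (1 + p * inverse t) * ((- 1) ^ card T * (\<sigma> T + inverse t))" if "T \<subseteq> B" for T t
    proof -
      have "insert k T - {k} = T" using that A by auto
      then show ?thesis using card_insert_subset[OF B A(2) that] by (simp add: g_def)
    qed
    have "f (x k) = 0"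
    proof (rule holomorphic_eq_0_if_removable[where f = f and Z = Z])
      show "finite Z" using B by (simp add: Z_def)
      show "f holomorphic_on - Z"
      proof -
        have "g S holomorphic_on - Z" for S
          unfolding g_def by (cases "k \<in> S") (auto simp: Z_def intro!: holomorphic_intros)
        then show ?thesis
          unfolding f_def by (intro holomorphic_sum_cut_weight B A) (auto simp: Z_def)
      qed
      show "x k \<notin> Z"
      proof
        assume "x k \<in> Z"
        then obtain j where j: "j \<in> B" "x k = x j \<or> x k = - x j" using k0 by (auto simp: Z_def)
        then have "k \<in> A" "j \<in> A" "k \<noteq> j" "(x k)\<^sup>2 = (x j)\<^sup>2" using A by auto
        then show False using less.prems(3) unfolding generic_def by metis
      qed
      show "(f \<longlongrightarrow> 0) at_infinity"
      proof -
        \<comment> \<open>Only the product of p-free growth, t times \<open>inverse t\<close>,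
          survives in \<open>g\<close>. Its coefficient depends on \<open>S\<close> through the sign
          and \<open>S - {k}\<close> alone, so \<open>T\<close> and \<open>insert k T\<close>
          cancel.\<close>
        define h where "h S = - a * ((- 1) ^ card S * \<sigma> (S - {k}))" for S
        have "(g S \<longlongrightarrow> 0 * ((1 / w) ^ card A * (- w\<^sup>2) ^ card S)
          - a * (1 + p * 0) * ((- 1) ^ card S * (\<sigma> (S - {k}) + (if k \<in> S then 0 else 0)))) at_infinity" for S
          unfolding g_def
          by (cases "k \<in> S") (simp_all only: if_True if_False, (intro tendsto_intros tendsto_inverse_0)+)
        then have "(g S \<longlongrightarrow> h S) at_infinity" for S by (simp add: h_def)
        from tendsto_sum_cut_weight_at_infinity[where g = g and h = h and a = a and x = x, OF B A(2) this]
        have "(f \<longlongrightarrow> (\<Sum>T\<in>Pow B. cut_weight a x B T * (h T + h (insert k T)))) at_infinity"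
          by (simp add: f_def)
        moreover have "h T + h (insert k T) = 0" if "T \<in> Pow B" for T
        proof -
          have "T \<subseteq> B" "insert k T - {k} = T" "T - {k} = T" using that A by auto
          then show ?thesis by (simp add: h_def card_insert_subset[OF B A(2)])
        qed
        ultimately show ?thesis by simp
      qed
      fix \<zeta> assume \<zeta>: "\<zeta> \<in> Z"
      show "((\<lambda>t. (t - \<zeta>) * f t) \<longlongrightarrow> 0) (at \<zeta>)"
      proof (cases "\<zeta> = 0")
        case True
        have xB: "x j \<noteq> 0" if "j \<in> B" for j using less.prems(3) A that by (auto simp: generic_def)
        have 0: "exp_sum a x B 1 = 0"
          using exp_sum_1_eq_0 B False generic_subset[OF less.prems(3)] A by blast
        have IH: "exp_sum a x B w = a * p * inv_sum a x B"
          unfolding p_def using less.hyps[of B] B False A generic_subset[OF less.prems(3), of B]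
          by auto
        have cA: "card A = Suc (card B)" using A B by simp
        let ?\<alpha> = "\<lambda>T t. \<Prod>j\<in>B - T. scat a t (x j)" and ?\<beta> = "\<lambda>T t. \<Prod>i\<in>T. scat a (x i) t"
        \<comment> \<open>The sum is t f(t) with c/t replaced by (c - 1)/t, where c is the product
          over \<open>B - T\<close>. The difference is a(t + p)/t times
          \<open>exp_sum a x B 1\<close>, which is 0, and now every term has a limit.\<close>
        have lim: "((\<lambda>t. \<Sum>T\<in>Pow B. ((1 / w) ^ card A * (- w\<^sup>2) ^ card T * (?\<beta> T t - w\<^sup>2 * ?\<alpha> T t)
             + a * (t + p) * (- 1) ^ card T * (\<sigma> T * (?\<alpha> T t - ?\<beta> T t) + (?\<alpha> T t - 1) / t)) * cut_weight a x B T)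
           \<longlongrightarrow> (\<Sum>T\<in>Pow B. ((1 / w) ^ card A * (- w\<^sup>2) ^ card T * ((\<Prod>i\<in>T. 1) - w\<^sup>2 * (\<Prod>j\<in>B - T. 1))
             + a * (0 + p) * (- 1) ^ card T *
               (\<sigma> T * ((\<Prod>j\<in>B - T. 1) - (\<Prod>i\<in>T. 1)) + - a * (\<Sum>j\<in>B - T. 1 / x j))) * cut_weight a x B T)) (at 0)"
        proof -
          have d: "((\<lambda>t. (?\<alpha> T t - 1) / t) \<longlongrightarrow> - a * (\<Sum>j\<in>B - T. 1 / x j)) (at 0)" for T
            using DERIV_prod_scat_0[of "B - T" x a] B xB by (simp add: DERIV_def)
          have s: "((\<lambda>t. scat a t (x j)) \<longlongrightarrow> 1) (at 0)" "((\<lambda>t. scat a (x j) t) \<longlongrightarrow> 1) (at 0)" if "j \<in> B" for j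
          proof -
            have "((\<lambda>t. scat a t (x j)) \<longlongrightarrow> scat a 0 (x j)) (at 0)" "((\<lambda>t. scat a (x j) t) \<longlongrightarrow> scat a (x j) 0) (at 0)"
              using xB[OF that] by (intro tendsto_intros; simp)+
            then show "((\<lambda>t. scat a t (x j)) \<longlongrightarrow> 1) (at 0)" "((\<lambda>t. scat a (x j) t) \<longlongrightarrow> 1) (at 0)"
              by simp_all
          qed
          show ?thesis
            by (intro tendsto_sum tendsto_mult tendsto_add tendsto_diff tendsto_prod tendsto_const
                tendsto_ident_at d s) auto
        qed
        \<comment> \<open>The split of the sum over \<open>B - T\<close> into the sum over
          \<open>B\<close> minus that over \<open>T\<close> brings the limit to the form -a times
          (\<open>exp_sum\<close> - a p \<open>inv_sum\<close>) over \<open>B\<close>, up to a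
          multiple of \<open>exp_sum a x B 1\<close>.\<close>
        have "(\<Sum>T\<in>Pow B. ((1 / w) ^ card A * (- w\<^sup>2) ^ card T * ((\<Prod>i\<in>T. 1) - w\<^sup>2 * (\<Prod>j\<in>B - T. 1))
             + a * (0 + p) * (- 1) ^ card T *
               (\<sigma> T * ((\<Prod>j\<in>B - T. 1) - (\<Prod>i\<in>T. 1)) + - a * (\<Sum>j\<in>B - T. 1 / x j))) * cut_weight a x B T)
          = (\<Sum>T\<in>Pow B. ((1 - w\<^sup>2) / w * ((1 / w) ^ card B * (- w\<^sup>2) ^ card T)
              + a\<^sup>2 * p * ((- 1) ^ card T * (\<Sum>i\<in>T. 1 / x i)) + (- a\<^sup>2 * p * \<sigma> B) * (- 1) ^ card T) * cut_weight a x B T)"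
        proof (intro sum.cong refl, goal_cases)
          case (1 T)
          then have \<sigma>: "\<sigma> (B - T) = \<sigma> B - \<sigma> T"
            unfolding \<sigma>_def using B by (subst sum_diff) auto
          show ?case unfolding cA \<sigma>_def[symmetric] \<sigma> using assms(4)
            by (simp add: field_simps power2_eq_square)
        qed
        also have "\<dots> = 0"
          unfolding sum_Pow_cut_weight_linear a 0 IH by (simp add: power2_eq_square)
        finally have lim0: "((\<lambda>t. \<Sum>T\<in>Pow B. ((1 / w) ^ card A * (- w\<^sup>2) ^ card T * (?\<beta> T t - w\<^sup>2 * ?\<alpha> T t)
             + a * (t + p) * (- 1) ^ card T * (\<sigma> T * (?\<alpha> T t - ?\<beta> T t) + (?\<alpha> T t - 1) / t)) * cut_weight a x B T)
           \<longlongrightarrow> 0) (at 0)" using lim by (simp only:)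
        have "\<forall>\<^sub>F t in at 0. t \<noteq> (0::complex)" by (simp add: eventually_at_filter)
        then have "\<forall>\<^sub>F t in at 0. (\<Sum>T\<in>Pow B. ((1 / w) ^ card A * (- w\<^sup>2) ^ card T * (?\<beta> T t - w\<^sup>2 * ?\<alpha> T t)
             + a * (t + p) * (- 1) ^ card T * (\<sigma> T * (?\<alpha> T t - ?\<beta> T t) + (?\<alpha> T t - 1) / t)) * cut_weight a x B T)
           = (t - 0) * f t"
        proof eventually_elim
          case (elim t)
          have "(t - 0) * f t = (\<Sum>T\<in>Pow B. t * (g T t * ?\<beta> T t + g (insert k T) t * ?\<alpha> T t) * cut_weight a x B T)"
            unfolding f_def sum_cut_weight_insert[OF B A(2)] by (simp add: sum_distrib_left mult_ac)
          also have "\<dots> = (\<Sum>T\<in>Pow B. (((1 / w) ^ card A * (- w\<^sup>2) ^ card T * (?\<beta> T t - w\<^sup>2 * ?\<alpha> T t)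
             + a * (t + p) * (- 1) ^ card T * (\<sigma> T * (?\<alpha> T t - ?\<beta> T t) + (?\<alpha> T t - 1) / t)) * cut_weight a x B T
             + a * (t + p) / t * ((- 1) ^ card T * cut_weight a x B T)))"
          proof (intro sum.cong refl, goal_cases)
            case (1 T)
            have tp: "t * (1 + p * inverse t) = t + p" "t * inverse t = 1" using elim by (simp_all add: field_simps)
            have "t * (g T t * b + g (insert k T) t * c) =
               (t * inverse t) * ((1 / w) ^ card A * (- w\<^sup>2) ^ card T) * (b - w\<^sup>2 * c)
               + a * (t * (1 + p * inverse t)) * (- 1) ^ card T * (\<sigma> T * (c - b) + c * inverse t)" for b c
              using 1 by (simp add: g_notin g_in algebra_simps)
            note eq = this[of "?\<beta> T t" "?\<alpha> T t", unfolded tp]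
            show ?case by (subst eq) (simp add: divide_inverse algebra_simps)
          qed
          also have "\<dots> = (\<Sum>T\<in>Pow B. ((1 / w) ^ card A * (- w\<^sup>2) ^ card T * (?\<beta> T t - w\<^sup>2 * ?\<alpha> T t)
             + a * (t + p) * (- 1) ^ card T * (\<sigma> T * (?\<alpha> T t - ?\<beta> T t) + (?\<alpha> T t - 1) / t)) * cut_weight a x B T)
             + a * (t + p) / t * exp_sum a x B 1"
            by (simp only: sum.distrib exp_sum_1 sum_distrib_left)
          finally show ?case by (simp only: 0 mult_zero_right add_0_right)
        qed
        from Lim_transform_eventually[OF lim0 this] show ?thesis using True by simp
      next
        case False
        then obtain j where j: "j \<in> B" "\<zeta> = x j \<or> \<zeta> = - x j" using \<zeta> by (auto simp: Z_def)
        then have xj: "x j \<noteq> 0" using False by auto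
        define C where "C = B - {j}"
        have C: "finite C" "k \<notin> C" "j \<notin> C" "j \<noteq> k" "B = insert j C" using B A j by (auto simp: C_def)
        have genC: "generic x C" "generic x (insert j C)"
          using generic_subset[OF less.prems(3)] A C(5) by auto
        have cA: "card A = Suc (Suc (card C))" using A B C by simp
        have pC: "p = x j + (\<Sum>i\<in>C. x i)" using C by (simp add: p_def)
        define q where "q = (\<Sum>i\<in>C. x i)"
        have sum0: "C \<noteq> {} \<Longrightarrow> exp_sum a x C 1 = 0"
          using exp_sum_1_eq_0[OF C(1)] genC by blast
        have IH: "C \<noteq> {} \<Longrightarrow> exp_sum a x C w = a * q * inv_sum a x C"
          using less.hyps[of C] C(1-4) genC(1) by (simp add: q_def A(1) C(5))
        \<comment> \<open>At t = -x_j the total t + p is q, the total over \<open>C\<close>.\<close>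
        have tp: "1 + p * inverse (- x j) = q * inverse (- x j)"
          using xj by (simp add: pC q_def field_simps)
        \<comment> \<open>The w^2 of the additional element compensates the two deleted variables:
          w^2 (1/w)^(|C| + 2) = (1/w)^|C|.\<close>
        have gk: "g (insert k T) (- x j) = - inverse (- x j) * ((1 / w) ^ card C * (- w\<^sup>2) ^ card T)
            + a * q * inverse (- x j) * ((- 1) ^ card T * (\<Sum>i\<in>T. 1 / x i))
            + a * q * inverse (- x j) * inverse (- x j) * (- 1) ^ card T" if "T \<subseteq> C" for T
          using g_in[of T "- x j", unfolded tp] that C(5) assms(4) unfolding \<sigma>_def[symmetric]
          by (auto simp: cA power2_eq_square algebra_simps)
        have gj: "g (insert j T) t = - inverse t * ((1 / w) ^ card A * w\<^sup>2 * (- w\<^sup>2) ^ card T)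
            + a * (1 + p * inverse t) * ((- 1) ^ card T * (\<sigma> T + inverse (x j)))" if "T \<subseteq> C" for T t
        proof -
          have "insert j T \<subseteq> B" "j \<notin> T" "finite T" using that C finite_subset by auto
          then show ?thesis by (simp add: g_notin \<sigma>_def inverse_eq_divide algebra_simps)
        qed
        have gj': "g (insert j T) (- x j) = - inverse (- x j) * ((1 / w) ^ card C * (- w\<^sup>2) ^ card T)
            + a * q * inverse (- x j) * ((- 1) ^ card T * (\<Sum>i\<in>T. 1 / x i))
            + a * q * inverse (- x j) * inverse (x j) * (- 1) ^ card T" if "T \<subseteq> C" for T
          using gj[of T "- x j", unfolded tp] that assms(4) unfolding \<sigma>_def[symmetric]
          by (auto simp: cA power2_eq_square algebra_simps)
        show ?thesis
          unfolding f_def C(5)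
        proof (rule tendsto_pole_sum_cut_weight_0[where x = x and j = j and z = \<zeta> and g = g, OF C(1-4) genC(2) j(2)])
          show "(g S \<longlongrightarrow> g S \<zeta>) (at \<zeta>)" for S
            unfolding g_def using False by (cases "k \<in> S") (auto intro!: tendsto_intros)
          show "g (insert k T) (x j) = g (insert j T) (x j)" if "T \<subseteq> C" for T
            using that C(5) by (subst g_in) (auto simp: gj)
          \<comment> \<open>The formulas differ only in the sign of their last term, which contains
            the factor q, an empty sum here.\<close>
          show "g {k} (- x j) = g {j} (- x j)" if "C = {}"
            using gk[of "{}"] gj'[of "{}"] that by (simp add: q_def)
          have "(\<Sum>T\<in>Pow C. g (insert k T) (- x j) * cut_weight a x C T) =
             - inverse (- x j) * exp_sum a x C w + a * q * inverse (- x j) * inv_sum a x C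
              + a * q * inverse (- x j) * inverse (- x j) * exp_sum a x C 1"
            unfolding sum_Pow_cut_weight_linear[symmetric] using gk by (intro sum.cong) auto
          then show "(\<Sum>T\<in>Pow C. g (insert k T) (- x j) * cut_weight a x C T) = 0" if "C \<noteq> {}"
            using sum0 IH that by simp
          have "(\<Sum>T\<in>Pow C. g (insert j T) (- x j) * cut_weight a x C T) =
             - inverse (- x j) * exp_sum a x C w + a * q * inverse (- x j) * inv_sum a x C
              + a * q * inverse (- x j) * inverse (x j) * exp_sum a x C 1"
            unfolding sum_Pow_cut_weight_linear[symmetric] using gj' by (intro sum.cong) auto
          then show "(\<Sum>T\<in>Pow C. g (insert j T) (- x j) * cut_weight a x C T) = 0" if "C \<noteq> {}"
            using sum0 IH that by simp
        qed
      qed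
    qed
    moreover have "x k * f (x k) = exp_sum a x A w - a * (\<Sum>i\<in>A. x i) * inv_sum a x A"
    proof -
      have "x k * g S (x k) = (1 / w) ^ card A * (- w\<^sup>2) ^ card S
          - a * (\<Sum>i\<in>A. x i) * ((- 1) ^ card S * (\<Sum>i\<in>S. 1 / x i))" if "S \<in> Pow A" for S
      proof -
        have "finite S" using that less.prems(1) finite_subset by auto
        then have s: "\<sigma> (S - {k}) + (if k \<in> S then inverse (x k) else 0) = (\<Sum>i\<in>S. 1 / x i)"
          unfolding \<sigma>_def by (simp add: sum_diff1 inverse_eq_divide)
        have "x k * (1 + p * inverse (x k)) = (\<Sum>i\<in>A. x i)"
          using k0 A B by (simp add: p_def field_simps)
        moreover have "x k * g S (x k) = (x k * inverse (x k)) * ((1 / w) ^ card A * (- w\<^sup>2) ^ card S)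
          - a * (x k * (1 + p * inverse (x k))) * ((- 1) ^ card S * (\<Sum>i\<in>S. 1 / x i))"
          unfolding g_def s by (simp add: algebra_simps)
        ultimately show ?thesis using k0 by simp
      qed
      then have "x k * f (x k) = (\<Sum>S\<in>Pow A. ((1 / w) ^ card A * (- w\<^sup>2) ^ card S
          - a * (\<Sum>i\<in>A. x i) * ((- 1) ^ card S * (\<Sum>i\<in>S. 1 / x i))) * cut_weight a x A S)"
        unfolding f_def sum_distrib_left A(1)[symmetric]
        by (intro sum.cong refl) (simp only: mult.assoc[symmetric] fun_upd_triv)
      also have "\<dots> = exp_sum a x A w - a * (\<Sum>i\<in>A. x i) * inv_sum a x A"
        using sum_Pow_cut_weight_linear[of 1 w A "- a * (\<Sum>i\<in>A. x i)" x 0 a] by simp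
      finally show ?thesis .
    qed
    ultimately show ?thesis by simp
  qed
qed

section \<open>The K-functions\<close>

lemma prod_pairs:
  fixes h :: "nat \<Rightarrow> nat \<Rightarrow> complex"
  assumes "\<And>i. h i i = 1"
  shows "(\<Prod>j=1..n. \<Prod>i=1..<j. h i j * h j i) = (\<Prod>i=1..n. \<Prod>j=1..n. h i j)"
proof (induction n)
  case (Suc n)
  have "(\<Prod>j=1..Suc n. \<Prod>i=1..<j. h i j * h j i) =
    (\<Prod>i=1..n. \<Prod>j=1..n. h i j) * ((\<Prod>i=1..n. h i (Suc n)) * (\<Prod>j=1..n. h (Suc n) j))"
    using Suc by (simp add: atLeastLessThanSuc_atLeastAtMost prod.distrib[of "\<lambda>i. h i (Suc n)"])
  also have "\<dots> = (\<Prod>i=1..Suc n. \<Prod>j=1..Suc n. h i j)"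
    by (simp add: assms prod.distrib mult.assoc)
  finally show ?case .
qed simp

text \<open>The fraction is expanded by 2 exp(y) exp(z), which is never 0. So the equation also
  holds where sinh(y - z) = 0: both fractions are then 0 by convention.\<close>

lemma scat_exp: "1 + \<i> * s / sinh (y - z) = scat (2 * \<i> * s) (exp y) (exp z)"
proof -
  have eq: "sinh (y - z) * (2 * exp y * exp z) = (exp y)\<^sup>2 - (exp z)\<^sup>2"
    by (simp add: sinh_field_def exp_diff field_simps power2_eq_square)
  have "\<i> * s / sinh (y - z) = \<i> * s * (2 * exp y * exp z) / (sinh (y - z) * (2 * exp y * exp z))"
    by (rule nonzero_mult_divide_mult_cancel_right[symmetric]) simp
  also have "\<dots> = 2 * \<i> * s * exp y * exp z / ((exp y)\<^sup>2 - (exp z)\<^sup>2)"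
    unfolding eq by (simp add: mult_ac)
  finally have "\<i> * s / sinh (y - z) = 2 * \<i> * s * exp y * exp z / ((exp y)\<^sup>2 - (exp z)\<^sup>2)" .
  then show ?thesis by (simp add: scat_def)
qed

lemma prod_pairs_eq_cut_weight:
  fixes \<theta> :: "nat \<Rightarrow> complex" and l :: "nat \<Rightarrow> nat"
  assumes "l \<in> {1..n} \<rightarrow>\<^sub>E {0, 1}"
  shows "(\<Prod>j=1..n. \<Prod>i=1..<j. 1 + (of_nat (l i) - of_nat (l j)) * (\<i> * s / sinh (\<theta> i - \<theta> j)))
    = cut_weight (2 * \<i> * s) (\<lambda>i. exp (\<theta> i)) {1..n} {i \<in> {1..n}. l i = 1}"
proof -
  define S where "S = {i \<in> {1..n}. l i = 1}"
  \<comment> \<open>\<open>h i j * h j i\<close> is the factor of the unordered pair, and at most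
    one of the two differs from 1. Summation indices ordered by i < j thus give way to a product
    over all ordered pairs.\<close>
  define h where "h i j = (if i \<in> S \<and> j \<in> {1..n} - S then scat (2 * \<i> * s) (exp (\<theta> i)) (exp (\<theta> j)) else 1)" for i j
  have swap: "sinh (\<theta> i - \<theta> j) = - sinh (\<theta> j - \<theta> i)" for i j
    by (metis minus_diff_eq sinh_minus)
  have "(\<Prod>j=1..n. \<Prod>i=1..<j. 1 + (of_nat (l i) - of_nat (l j)) * (\<i> * s / sinh (\<theta> i - \<theta> j)))
      = (\<Prod>j=1..n. \<Prod>i=1..<j. h i j * h j i)"
  proof (intro prod.cong refl)
    fix i j assume ij: "j \<in> {1..n}" "i \<in> {1..<j}"
    then have "l i \<in> {0, 1}" "l j \<in> {0, 1}" using assms by (auto simp: PiE_iff)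
    then consider "l i = l j" | "l i = 1" "l j = 0" | "l i = 0" "l j = 1" by auto
    then show "1 + (of_nat (l i) - of_nat (l j)) * (\<i> * s / sinh (\<theta> i - \<theta> j)) = h i j * h j i"
    proof cases
      case 1
      then show ?thesis using ij by (auto simp: h_def S_def)
    next
      case 2
      then show ?thesis using ij by (auto simp: h_def S_def scat_exp)
    next
      case 3
      then show ?thesis using ij swap[of i j] by (auto simp: h_def S_def scat_exp[symmetric])
    qed
  qed
  also have "\<dots> = (\<Prod>i=1..n. \<Prod>j=1..n. h i j)"
    by (rule prod_pairs) (auto simp: h_def)
  also have "\<dots> = (\<Prod>i\<in>S. \<Prod>j=1..n. h i j)"
    by (rule prod.mono_neutral_right) (auto simp: S_def h_def)
  also have "\<dots> = (\<Prod>i\<in>S. \<Prod>j\<in>{1..n} - S. h i j)"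
    by (intro prod.cong refl prod.mono_neutral_right) (auto simp: h_def)
  also have "\<dots> = cut_weight (2 * \<i> * s) (\<lambda>i. exp (\<theta> i)) {1..n} S"
    unfolding cut_weight_def by (intro prod.cong refl) (auto simp: h_def)
  finally show ?thesis by (simp add: S_def)
qed

lemma K_function_eq_sum_cut_weight:
  assumes "\<And>l. l \<in> {1..n} \<rightarrow>\<^sub>E {0, 1} \<Longrightarrow> p n \<theta> l = P {i \<in> {1..n}. l i = 1}"
  shows "K_function \<nu> p n \<theta> = (\<Sum>S\<in>Pow {1..n}. (- 1) ^ card S
    * cut_weight (2 * \<i> * complex_of_real (sin (pi * \<nu>))) (\<lambda>i. exp (\<theta> i)) {1..n} S * P S)"
  unfolding K_function_def
proof (rule sum.reindex_bij_witness[where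
      i = "\<lambda>S. restrict (\<lambda>i. if i \<in> S then 1 else 0) {1..n}" and j = "\<lambda>l. {i \<in> {1..n}. l i = 1}"])
  fix l assume l: "l \<in> {1..n} \<rightarrow>\<^sub>E {0, 1 :: nat}"
  show "restrict (\<lambda>i. if i \<in> {i \<in> {1..n}. l i = 1} then 1 else 0) {1..n} = l"
  proof
    fix i
    show "restrict (\<lambda>i. if i \<in> {i \<in> {1..n}. l i = 1} then 1 else 0) {1..n} i = l i"
      using PiE_mem[OF l, of i] PiE_arb[OF l, of i] by (cases "i \<in> {1..n}") auto
  qed
  have "(\<Sum>i=1..n. l i) = (\<Sum>i=1..n. if l i = 1 then 1 else 0)"
    using l by (intro sum.cong) (auto simp: PiE_iff)
  also have "\<dots> = card {i \<in> {1..n}. l i = 1}" by (simp add: sum.If_cases Int_def)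
  finally have "(\<Sum>i=1..n. l i) = card {i \<in> {1..n}. l i = 1}" .
  then show "(- 1) ^ card {i \<in> {1..n}. l i = 1}
      * cut_weight (2 * \<i> * complex_of_real (sin (pi * \<nu>))) (\<lambda>i. exp (\<theta> i)) {1..n} {i \<in> {1..n}. l i = 1}
      * P {i \<in> {1..n}. l i = 1} =
    (- 1) ^ (\<Sum>i=1..n. l i) * (\<Prod>j=1..n. \<Prod>i=1..<j. 1 + (of_nat (l i) - of_nat (l j)) *
        (\<i> * complex_of_real (sin (pi * \<nu>)) / sinh (\<theta> i - \<theta> j))) * p n \<theta> l"
    unfolding prod_pairs_eq_cut_weight[OF l] assms[OF l] by simp
qed (auto simp: PiE_iff)

text \<open>The p-function is w^(2|S| - n). Keeping \<open>c\<close> free covers both \<gamma> =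
  \<beta> and \<gamma> = -\<beta>, with c = pi \<nu> and c = -pi \<nu>.\<close>

lemma K_function_p_exp:
  assumes "pi * coupling_nu \<beta> * \<gamma> / \<beta> = c"
  shows "K_function \<nu> (p_exp \<beta> \<gamma>) n \<theta> =
    exp_sum (2 * \<i> * complex_of_real (sin (pi * \<nu>))) (\<lambda>i. exp (\<theta> i)) {1..n} (exp (\<i> * complex_of_real c))"
proof -
  define w where "w = exp (\<i> * complex_of_real c)"
  have w: "w \<noteq> 0" by (simp add: w_def)
  have "p_exp \<beta> \<gamma> n \<theta> l = (1 / w) ^ n * (w\<^sup>2) ^ card {i \<in> {1..n}. l i = 1}" if l: "l \<in> {1..n} \<rightarrow>\<^sub>E {0, 1}" for l
  proof -
    have "p_exp \<beta> \<gamma> n \<theta> l = (\<Prod>i=1..n. 1 / w * (if l i = 1 then w\<^sup>2 else 1))"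
      unfolding p_exp_def assms
    proof (intro prod.cong refl)
      fix i assume "i \<in> {1..n}"
      then have "l i = 0 \<or> l i = 1" using l by (auto simp: PiE_iff)
      then show "exp ((2 * of_nat (l i) - 1) * \<i> * complex_of_real c) = 1 / w * (if l i = 1 then w\<^sup>2 else 1)"
        using w by (auto simp: w_def power2_eq_square exp_minus inverse_eq_divide)
    qed
    also have "\<dots> = (1 / w) ^ n * (w\<^sup>2) ^ card {i \<in> {1..n}. l i = 1}"
      unfolding prod.distrib by (simp add: prod.If_cases Int_def)
    finally show ?thesis .
  qed
  from K_function_eq_sum_cut_weight[where p = "p_exp \<beta> \<gamma>", OF this] show ?thesis
    unfolding exp_sum_def w_def[symmetric]
    by (simp add: power_minus[of "w\<^sup>2"] mult_ac)
qed

text \<open>Needed because the exponential with -\<beta> gives w = 1/q, whereas the second root of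
  \<open>w - 1 / w = a\<close> is -1/q.\<close>

lemma exp_sum_uminus: "exp_sum a x A (- w) = (- 1) ^ card A * exp_sum a x A w"
  by (simp add: exp_sum_def sum_distrib_left power_minus[of "1 / w"] mult_ac)

text \<open>With r = exp(i pi \<nu>/2), exp(-z_i) is i r / x_i or i / (r x_i). The sum over i is
  therefore i(r - 1/r) times the sum of 1/x_i over \<open>S\<close>, plus a term independent of
  \<open>S\<close> that \<open>exp_sum_1_eq_0\<close> kills. The constant is i(r - 1/r) = -2 sin(pi
  \<nu>/2).\<close>

lemma K_function_p_trace:
  assumes "n \<ge> 1" "generic (\<lambda>i. exp (\<theta> i)) {1..n}"
  shows "K_function \<nu> (p_trace \<nu>) n \<theta> = - 2 * complex_of_real (sin (pi * \<nu> / 2)) * (\<Sum>i=1..n. exp (\<theta> i))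
    * inv_sum (2 * \<i> * complex_of_real (sin (pi * \<nu>))) (\<lambda>i. exp (\<theta> i)) {1..n}"
proof -
  define a where "a = 2 * \<i> * complex_of_real (sin (pi * \<nu>))"
  define x where "x = (\<lambda>i. exp (\<theta> i))"
  define r where "r = exp (\<i> * complex_of_real (pi * \<nu> / 2))"
  define P where "P = (\<Sum>i=1..n. x i)"
  have r: "r \<noteq> 0" by (simp add: r_def)
  have exp_z: "exp (- z_shift \<nu> \<theta> l i) = \<i> * (if l i = 1 then r else 1 / r) * (1 / x i)"
    if "l i \<in> {0, 1}" for l i
  proof -
    have "- z_shift \<nu> \<theta> l i = - \<theta> i + \<i> * complex_of_real (pi / 2) + (2 * of_nat (l i) - 1) * (\<i> * complex_of_real (pi * \<nu> / 2))"
      by (simp add: z_shift_def field_simps)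
    moreover have "exp (\<i> * complex_of_real (pi / 2)) = \<i>" by (simp add: exp_eq_polar flip: cis_conv_exp)
    moreover have "exp ((2 * of_nat (l i) - 1) * (\<i> * complex_of_real (pi * \<nu> / 2))) = (if l i = 1 then r else 1 / r)"
      using that by (auto simp: r_def exp_minus inverse_eq_divide)
    ultimately show ?thesis by (simp only: exp_add) (simp add: x_def exp_minus inverse_eq_divide)
  qed
  have "p_trace \<nu> n \<theta> l = \<i> * P * ((r - 1 / r) * (\<Sum>i | i \<in> {1..n} \<and> l i = 1. 1 / x i) + 1 / r * (\<Sum>i=1..n. 1 / x i))"
    if l: "l \<in> {1..n} \<rightarrow>\<^sub>E {0, 1}" for l
  proof -
    have "(\<Sum>i=1..n. exp (- z_shift \<nu> \<theta> l i)) = (\<Sum>i=1..n. \<i> * ((r - 1 / r) * (if l i = 1 then 1 / x i else 0) + 1 / r * (1 / x i)))"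
    proof (intro sum.cong refl)
      fix i assume "i \<in> {1..n}"
      then have "l i \<in> {0, 1}" using l by (auto simp: PiE_iff)
      then show "exp (- z_shift \<nu> \<theta> l i) = \<i> * ((r - 1 / r) * (if l i = 1 then 1 / x i else 0) + 1 / r * (1 / x i))"
        by (auto simp: exp_z algebra_simps)
    qed
    also have "\<dots> = \<i> * ((r - 1 / r) * (\<Sum>i=1..n. if l i = 1 then 1 / x i else 0) + 1 / r * (\<Sum>i=1..n. 1 / x i))"
      by (simp only: sum_distrib_left[symmetric] sum.distrib)
    also have "(\<Sum>i=1..n. if l i = 1 then 1 / x i else 0) = (\<Sum>i | i \<in> {1..n} \<and> l i = 1. 1 / x i)"
      by (rule sum.inter_filter[symmetric]) simp
    finally show ?thesis by (simp add: p_trace_def P_def x_def)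
  qed
  from K_function_eq_sum_cut_weight[where p = "p_trace \<nu>" and P = "\<lambda>S. \<i> * P * ((r - 1 / r) * (\<Sum>i\<in>S. 1 / x i) + 1 / r * (\<Sum>i=1..n. 1 / x i))", OF this]
  have "K_function \<nu> (p_trace \<nu>) n \<theta> = (\<Sum>S\<in>Pow {1..n}. (- 1) ^ card S * cut_weight a x {1..n} S
      * (\<i> * P * ((r - 1 / r) * (\<Sum>i\<in>S. 1 / x i) + 1 / r * (\<Sum>i=1..n. 1 / x i))))"
    by (simp add: a_def x_def)
  also have "\<dots> = (\<Sum>S\<in>Pow {1..n}. (0 * ((1 / 1) ^ card {1..n} * (- 1\<^sup>2) ^ card S)
      + (\<i> * P * (r - 1 / r)) * ((- 1) ^ card S * (\<Sum>i\<in>S. 1 / x i))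
      + (\<i> * P * (1 / r * (\<Sum>i=1..n. 1 / x i))) * (- 1) ^ card S) * cut_weight a x {1..n} S)"
    by (intro sum.cong refl) (simp only: algebra_simps mult_zero_left add_0)
  also have "\<dots> = \<i> * P * (r - 1 / r) * inv_sum a x {1..n}"
    unfolding sum_Pow_cut_weight_linear using exp_sum_1_eq_0[of "{1..n}" x a] assms by (simp add: x_def)
  also have "r - 1 / r = 2 * \<i> * complex_of_real (sin (pi * \<nu> / 2))"
  proof -
    have "1 / r = exp (- (\<i> * complex_of_real (pi * \<nu> / 2)))" by (simp add: r_def exp_minus inverse_eq_divide)
    then show ?thesis
      by (simp add: r_def sin_of_real[symmetric] sin_exp_eq field_simps)
  qed
  finally show ?thesis by (simp add: a_def x_def P_def)
qed

section \<open>Integral evaluations\<close>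

lemma measurable_sinh [measurable]: "(sinh :: real \<Rightarrow> real) \<in> borel_measurable borel"
  and measurable_cosh [measurable]: "(cosh :: real \<Rightarrow> real) \<in> borel_measurable borel"
  by (intro borel_measurable_continuous_onI continuous_intros)+

section \<open>Partial fractions of the tangent and the sinh integral\<close>

text \<open>The derivative of the reflection formula, taken for the entire function 1/Gamma.\<close>

lemma Digamma_reflection_real:
  fixes z :: real
  assumes "0 < z" "z < 1"
  shows "(Digamma (1 - z) - Digamma z) * sin (pi * z) = pi * cos (pi * z)"
proof -
  have refl: "rGamma z * rGamma (1 - z) = sin (pi * z) / pi" for z :: real
  proof -
    have "complex_of_real (rGamma z * rGamma (1 - z)) = complex_of_real (sin (pi * z) / pi)"
      using rGamma_reflection_complex[of "complex_of_real z"]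
      by (simp add: rGamma_complex_of_real[symmetric] sin_of_real[symmetric])
    then show ?thesis by (simp only: of_real_eq_iff)
  qed
  have n: "z \<notin> \<int>\<^sub>\<le>\<^sub>0" "1 - z \<notin> \<int>\<^sub>\<le>\<^sub>0" using assms by (auto elim!: nonpos_Ints_cases)
  have r: "((\<lambda>y. rGamma (1 - y)) has_field_derivative - (- rGamma (1 - z) * Digamma (1 - z))) (at z)"
  proof -
    have "((\<lambda>y. rGamma (1 - y)) has_field_derivative (- rGamma (1 - z) * Digamma (1 - z)) * (0 - 1)) (at z)"
      by (rule DERIV_chain2[where f = rGamma and g = "\<lambda>y. 1 - y"])
        (rule has_field_derivative_rGamma_no_nonpos_int[OF n(2)], auto intro!: derivative_eq_intros)
    then show ?thesis by simp
  qed
  have "((\<lambda>y. rGamma y * rGamma (1 - y)) has_field_derivative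
      (- rGamma z * Digamma z) * rGamma (1 - z) + - (- rGamma (1 - z) * Digamma (1 - z)) * rGamma z) (at z)"
    by (rule DERIV_mult[OF has_field_derivative_rGamma_no_nonpos_int[OF n(1)] r])
  moreover have "((\<lambda>y. rGamma y * rGamma (1 - y)) has_field_derivative cos (pi * z)) (at z)"
    unfolding refl by (auto intro!: derivative_eq_intros)
  ultimately have "cos (pi * z) = (- rGamma z * Digamma z) * rGamma (1 - z) + - (- rGamma (1 - z) * Digamma (1 - z)) * rGamma z"
    by (rule DERIV_unique[symmetric])
  also have "\<dots> = (rGamma z * rGamma (1 - z)) * (Digamma (1 - z) - Digamma z)" by (simp add: algebra_simps)
  finally show ?thesis unfolding refl by (simp add: field_simps)
qed

text \<open>With z = (1 - s)/2 the terms are halves of 1/(z + k) and 1/(1 - z + k). The logarithms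
  in the Digamma limits cancel, and cot(pi z) = tan(pi s/2).\<close>

lemma tan_sums:
  fixes s :: real
  assumes "0 < s" "s < 1"
  shows "(\<lambda>k. 1 / (2 * real k + 1 - s) - 1 / (2 * real k + 1 + s)) sums (pi / 2 * tan (pi * s / 2))"
proof -
  define z where "z = (1 - s) / 2"
  have z: "0 < z" "z < 1" using assms by (auto simp: z_def)
  have "(\<lambda>m. (of_real (ln (real m)) - (\<Sum>n<m. inverse (1 - z + of_nat n)))
      - (of_real (ln (real m)) - (\<Sum>n<m. inverse (z + of_nat n)))) \<longlonglongrightarrow> Digamma (1 - z) - Digamma z"
    using z by (intro tendsto_diff Digamma_LIMSEQ) auto
  moreover have "(of_real (ln (real m)) - (\<Sum>n<m. inverse (1 - z + of_nat n)))
      - (of_real (ln (real m)) - (\<Sum>n<m. inverse (z + of_nat n)))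
      = (\<Sum>n<m. inverse (z + of_nat n) - inverse (1 - z + of_nat n))" for m
    by (simp add: sum_subtractf)
  ultimately have "(\<lambda>n. inverse (z + of_nat n) - inverse (1 - z + of_nat n)) sums (Digamma (1 - z) - Digamma z)"
    unfolding sums_def by simp
  then have "(\<lambda>n. 1 / 2 * (inverse (z + of_nat n) - inverse (1 - z + of_nat n))) sums (1 / 2 * (Digamma (1 - z) - Digamma z))"
    by (rule sums_mult)
  moreover have "1 / 2 * (inverse (z + of_nat n) - inverse (1 - z + of_nat n)) = 1 / (2 * real n + 1 - s) - 1 / (2 * real n + 1 + s)" for n
  proof -
    have "2 * real n + 1 - s = 2 * (z + real n)" "2 * real n + 1 + s = 2 * (1 - z + real n)"
      by (simp_all add: z_def field_simps)
    then show ?thesis by (simp only: inverse_eq_divide right_diff_distrib) simp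
  qed
  moreover have "1 / 2 * (Digamma (1 - z) - Digamma z) = pi / 2 * tan (pi * s / 2)"
  proof -
    have pz: "pi * z = pi / 2 - pi * s / 2" by (simp add: z_def field_simps)
    have "sin (pi * z) = cos (pi * s / 2)" "cos (pi * z) = sin (pi * s / 2)"
      unfolding pz by (simp_all add: sin_diff cos_diff)
    moreover have "cos (pi * s / 2) > 0" using assms by (intro cos_gt_zero) auto
    ultimately show ?thesis
      using Digamma_reflection_real[OF z] by (simp add: tan_def field_simps)
  qed
  ultimately show ?thesis by (simp only:)
qed

lemma nn_integral_exp_greaterThan:
  fixes a c :: real assumes "c > 0"
  shows "(\<integral>\<^sup>+t\<in>{a<..}. ennreal (exp (- c * t)) \<partial>lborel) = ennreal (exp (- c * a) / c)"
proof -
  have "(\<integral>\<^sup>+t\<in>{a<..}. ennreal (exp (- c * t)) \<partial>lborel) = (\<integral>\<^sup>+t. ennreal (exp (- c * t)) * indicator {a..} t \<partial>lborel)"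
    by (rule nn_integral_cong_AE) (use AE_lborel_singleton[of a] in eventually_elim, auto simp: indicator_def)
  also have "\<dots> = ennreal (0 - - exp (- c * a) / c)"
  proof (rule nn_integral_FTC_atLeast)
    show "((\<lambda>t. - exp (- c * t) / c) \<longlongrightarrow> 0) at_top"
    proof -
      have "((\<lambda>t. exp (- (c * t))) \<longlongrightarrow> 0) at_top"
        using assms by (intro filterlim_compose[OF exp_at_bot] filterlim_compose[OF filterlim_uminus_at_bot_at_top]
            filterlim_tendsto_pos_mult_at_top[OF tendsto_const] filterlim_ident)
      from tendsto_mult[OF tendsto_const[of "- 1 / c"] this] show ?thesis by simp
    qed
  qed (use assms in \<open>auto intro!: derivative_eq_intros\<close>)
  finally show ?thesis by simp
qed

text \<open>The geometric series for 1/sinh t in powers of exp(-2t).\<close>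

lemma sinh_ratio_sums:
  fixes s t :: real
  assumes "t > 0"
  shows "(\<lambda>k. exp (- (2 * real k + 1 - s) * t) - exp (- (2 * real k + 1 + s) * t)) sums (sinh (s * t) / sinh t)"
proof -
  have "(\<lambda>k. exp (- 2 * t) ^ k) sums (1 / (1 - exp (- 2 * t)))"
    using assms by (intro geometric_sums) simp
  then have "(\<lambda>k. (exp (- (1 - s) * t) - exp (- (1 + s) * t)) * exp (- 2 * t) ^ k) sums
      ((exp (- (1 - s) * t) - exp (- (1 + s) * t)) * (1 / (1 - exp (- 2 * t))))"
    by (rule sums_mult)
  moreover have "(exp (- (1 - s) * t) - exp (- (1 + s) * t)) * exp (- 2 * t) ^ k =
      exp (- (2 * real k + 1 - s) * t) - exp (- (2 * real k + 1 + s) * t)" for k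
    by (simp add: exp_of_nat_mult[symmetric] left_diff_distrib exp_add[symmetric] algebra_simps)
  moreover have "(exp (- (1 - s) * t) - exp (- (1 + s) * t)) * (1 / (1 - exp (- 2 * t))) = sinh (s * t) / sinh t"
  proof -
    have e: "exp (- (1 - s) * t) = exp (- t) * exp (s * t)" "exp (- (1 + s) * t) = exp (- t) * exp (- (s * t))"
      "exp (- 2 * t) = exp (- t) * exp (- t)" by (simp_all add: exp_add[symmetric] algebra_simps)
    have "sinh t = exp t * (1 - exp (- 2 * t)) / 2" unfolding e
      by (simp add: sinh_field_def right_diff_distrib exp_add[symmetric])
    moreover have "1 - exp (- 2 * t) \<noteq> 0" using assms by simp
    moreover have "(exp (- t) * X - exp (- t) * Y) * (1 / D) = (X - Y) / 2 / (exp t * D / 2)"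
      if "D \<noteq> 0" for X Y D :: real using that by (simp add: exp_minus field_simps)
    ultimately show ?thesis
      unfolding sinh_field_def[of "s * t"] e(1,2) by presburger
  qed
  ultimately show ?thesis by simp
qed

text \<open>The terms of the series are nonnegative, so it may be integrated term by term; this
  gives the partial fractions of the tangent.\<close>

lemma nn_integral_sinh_ratio:
  fixes s :: real
  assumes "0 < s" "s < 1"
  shows "(\<integral>\<^sup>+t\<in>{0<..}. ennreal (sinh (s * t) / sinh t) \<partial>lborel) = ennreal (pi / 2 * tan (pi * s / 2))"
proof -
  define u where "u k t = exp (- (2 * real k + 1 - s) * t) - exp (- (2 * real k + 1 + s) * t)" for k :: nat and t :: real
  have u0: "u k t \<ge> 0" if "t > 0" for k t
    using that assms by (simp add: u_def)
  have [measurable]: "u k \<in> borel_measurable borel" for k unfolding u_def by measurable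
  have int: "(\<integral>\<^sup>+t\<in>{0<..}. ennreal (u k t) \<partial>lborel) = ennreal (1 / (2 * real k + 1 - s) - 1 / (2 * real k + 1 + s))" for k
  proof -
    let ?a = "2 * real k + 1 - s" and ?b = "2 * real k + 1 + s"
    have "(\<integral>\<^sup>+t\<in>{0<..}. ennreal (u k t) \<partial>lborel) =
       (\<integral>\<^sup>+t. ennreal (exp (- ?a * t)) * indicator {0<..} t - ennreal (exp (- ?b * t)) * indicator {0<..} t \<partial>lborel)"
      by (intro nn_integral_cong) (auto simp: indicator_def u_def ennreal_minus)
    also have "\<dots> = (\<integral>\<^sup>+t\<in>{0<..}. ennreal (exp (- ?a * t)) \<partial>lborel) - (\<integral>\<^sup>+t\<in>{0<..}. ennreal (exp (- ?b * t)) \<partial>lborel)"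
    proof (rule nn_integral_diff)
      show "(\<integral>\<^sup>+t\<in>{0<..}. ennreal (exp (- ?b * t)) \<partial>lborel) \<noteq> \<infinity>"
        using assms by (subst nn_integral_exp_greaterThan) auto
      show "AE t in lborel. ennreal (exp (- ?b * t)) * indicator {0<..} t \<le> ennreal (exp (- ?a * t)) * indicator {0<..} t"
        using assms by (intro AE_I2) (auto simp: indicator_def)
    qed measurable
    also have "\<dots> = ennreal (1 / ?a) - ennreal (1 / ?b)"
      using nn_integral_exp_greaterThan[of ?a 0] nn_integral_exp_greaterThan[of ?b 0] assms by simp
    also have "\<dots> = ennreal (1 / ?a - 1 / ?b)" using assms by (intro ennreal_minus) auto
    finally show ?thesis .
  qed
  have "(\<integral>\<^sup>+t\<in>{0<..}. ennreal (sinh (s * t) / sinh t) \<partial>lborel) = (\<integral>\<^sup>+t. (\<Sum>k. ennreal (u k t) * indicator {0<..} t) \<partial>lborel)"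
  proof (intro nn_integral_cong)
    fix t :: real
    show "ennreal (sinh (s * t) / sinh t) * indicator {0<..} t = (\<Sum>k. ennreal (u k t) * indicator {0<..} t)"
    proof (cases "t > 0")
      case True
      then show ?thesis
        using suminf_ennreal_eq[OF u0[OF True] sinh_ratio_sums[OF True, of s, folded u_def]] by simp
    qed simp
  qed
  also have "\<dots> = (\<Sum>k. \<integral>\<^sup>+t\<in>{0<..}. ennreal (u k t) \<partial>lborel)"
    by (rule nn_integral_suminf) measurable
  also have "\<dots> = ennreal (pi / 2 * tan (pi * s / 2))"
    unfolding int by (rule suminf_ennreal_eq[OF _ tan_sums[OF assms]]) (use assms in \<open>simp add: frac_le\<close>)
  finally show ?thesis .
qed

section \<open>The cosh integral as a Beta integral\<close>

lemma nn_integral_Beta: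
  fixes a b :: real
  assumes "a > 0" "b > 0"
  shows "(\<integral>\<^sup>+t\<in>{0<..<1}. ennreal (t powr (a - 1) * (1 - t) powr (b - 1)) \<partial>lborel) = ennreal (Beta a b)"
proof -
  have B: "0 \<le> Beta a b"
    using has_integral_nonneg[OF has_integral_Beta_real[OF assms]] by simp
  have "((\<lambda>t. t powr (a - 1) * (1 - t) powr (b - 1)) has_integral Beta a b) {0<..<1}"
    using has_integral_Beta_real[OF assms] by (simp add: has_integral_Icc_iff_Ioo)
  moreover have "((\<lambda>t. indicator {0<..<1} t * (t powr (a - 1) * (1 - t) powr (b - 1))) has_integral Beta a b) UNIV"
    if "((\<lambda>t. t powr (a - 1) * (1 - t) powr (b - 1)) has_integral Beta a b) {0<..<1}"
  proof -
    have "(\<lambda>t. indicator {0<..<1} t * (t powr (a - 1) * (1 - t) powr (b - 1))) =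
        (\<lambda>t. if t \<in> {0<..<1} then t powr (a - 1) * (1 - t) powr (b - 1) else 0)"
      by (auto simp: fun_eq_iff indicator_def)
    then show ?thesis using that by (simp only: has_integral_restrict_UNIV)
  qed
  ultimately have "(\<integral>\<^sup>+t. ennreal (indicator {0<..<1} t * (t powr (a - 1) * (1 - t) powr (b - 1))) \<partial>lborel) = ennreal (Beta a b)"
    by (intro nn_integral_has_integral_lborel B) (auto simp: indicator_def)
  moreover have "(\<integral>\<^sup>+t\<in>{0<..<1}. ennreal (t powr (a - 1) * (1 - t) powr (b - 1)) \<partial>lborel) =
      (\<integral>\<^sup>+t. ennreal (indicator {0<..<1} t * (t powr (a - 1) * (1 - t) powr (b - 1))) \<partial>lborel)"
    by (intro nn_integral_cong) (simp add: indicator_def)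
  ultimately show ?thesis by simp
qed

lemma Beta_reflection:
  fixes s :: real
  assumes "0 < s" "s < 1"
  shows "Beta (1 + s) (1 - s) = pi * s / sin (pi * s)"
proof -
  have "complex_of_real (Gamma s * Gamma (1 - s)) = complex_of_real (pi / sin (pi * s))"
    using Gamma_reflection_complex[of "complex_of_real s"]
    by (simp add: Gamma_complex_of_real[symmetric] sin_of_real[symmetric])
  then have "Gamma s * Gamma (1 - s) = pi / sin (pi * s)" by (simp only: of_real_eq_iff)
  moreover have "Gamma (s + 1) = s * Gamma s" using assms by (intro Gamma_plus1) (auto elim!: nonpos_Ints_cases)
  ultimately show ?thesis using assms by (simp add: Beta_def add.commute Gamma_numeral field_simps)
qed

text \<open>The substitution \<open>u = exp t / (1 + exp t)\<close> turns the integral into a Beta integral.\<close>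

lemma nn_integral_exp_cosh:
  fixes s :: real
  assumes "0 < s" "s < 1"
  shows "(\<integral>\<^sup>+t. ennreal (exp (s * t) / (1 + cosh t)) \<partial>lborel) = ennreal (2 * (pi * s / sin (pi * s)))"
proof -
  define f where "f t = exp (s * t) / (1 + cosh t)" for t :: real
  \<comment> \<open>The inverse of the substitution. Since 1 + cosh t = 1/(2u(1 - u)) and g'(u) =
    1/(u(1 - u)), the Jacobian leaves the constant 2.\<close>
  define g where "g u = ln u - ln (1 - u)" for u :: real
  define g' where "g' u = 1 / u + 1 / (1 - u)" for u :: real
  have cosh1: "1 + cosh t > 0" for t :: real using cosh_real_pos[of t] by linarith
  have fg: "f (g u) * g' u = 2 * (u powr s * (1 - u) powr (- s))" if "0 < u" "u < 1" for u
  proof -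
    have e: "exp (g u) = u / (1 - u)" using that by (simp add: g_def exp_diff)
    have "exp (s * g u) = exp (s * ln u) * exp (- s * ln (1 - u))"
      by (simp add: g_def exp_add[symmetric] algebra_simps)
    then have "exp (s * g u) = u powr s * (1 - u) powr (- s)" using that by (simp add: powr_def)
    moreover have "g' u / (1 + cosh (g u)) = 2"
    proof -
      have e': "exp (- g u) = (1 - u) / u" using e by (simp add: exp_minus)
      have "1 + cosh (g u) = 1 / (2 * u * (1 - u))"
        unfolding cosh_field_def e e' using that by (simp add: field_simps)
      moreover have "g' u = 1 / (u * (1 - u))" using that by (simp add: g'_def field_simps)
      ultimately show ?thesis using that by simp
    qed
    moreover have "f (g u) * g' u = exp (s * g u) * (g' u / (1 + cosh (g u)))" by (simp add: f_def)
    ultimately show ?thesis by simp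
  qed
  have ei: "einterval 0 1 = {0<..<1}" by (auto simp: einterval_def)
  \<comment> \<open>The Beta value comes first because it also supplies the integrability that the
    substitution rule demands.\<close>
  have nn: "(\<integral>\<^sup>+u\<in>{0<..<1}. ennreal (f (g u) * g' u) \<partial>lborel) = ennreal (2 * (pi * s / sin (pi * s)))"
  proof -
    have "(\<integral>\<^sup>+u\<in>{0<..<1}. ennreal (f (g u) * g' u) \<partial>lborel) =
        (\<integral>\<^sup>+u. 2 * (ennreal (u powr (1 + s - 1) * (1 - u) powr (1 - s - 1)) * indicator {0<..<1} u) \<partial>lborel)"
      by (intro nn_integral_cong) (auto simp: indicator_def fg ennreal_mult)
    also have "\<dots> = 2 * ennreal (Beta (1 + s) (1 - s))"
      using nn_integral_Beta[of "1 + s" "1 - s"] assms by (subst nn_integral_cmult) auto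
    also have "\<dots> = ennreal (2 * (pi * s / sin (pi * s)))"
      unfolding Beta_reflection[OF assms] by (subst ennreal_mult') auto
    finally show ?thesis .
  qed
  have fg0: "0 \<le> f (g u) * g' u" if "0 < u" "u < 1" for u using fg[OF that] by simp
  have meas: "(\<lambda>u. indicator {0<..<1} u *\<^sub>R (f (g u) * g' u)) \<in> borel_measurable lborel"
    unfolding f_def g_def g'_def by measurable
  have nn': "(\<integral>\<^sup>+u. ennreal (indicator {0<..<1} u *\<^sub>R (f (g u) * g' u)) \<partial>lborel) = ennreal (2 * (pi * s / sin (pi * s)))"
    unfolding nn[symmetric] by (intro nn_integral_cong) (auto simp: indicator_def)
  have nonneg: "AE u in lborel. 0 \<le> indicator {0<..<1} u *\<^sub>R (f (g u) * g' u)"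
    by (intro AE_I2) (auto simp: indicator_def fg0)
  have int: "set_integrable lborel (einterval 0 1) (\<lambda>u. f (g u) * g' u)"
    unfolding set_integrable_def ei
    by (rule integrableI_nonneg[OF meas nonneg]) (simp only: nn' ennreal_less_top infinity_ennreal_def)
  have lim: "((ereal \<circ> g \<circ> real_of_ereal) \<longlongrightarrow> - \<infinity>) (at_right 0)"
      "((ereal \<circ> g \<circ> real_of_ereal) \<longlongrightarrow> \<infinity>) (at_left 1)"
  proof -
    have ln0: "LIM u at_right 0. - ln u :> (at_top :: real filter)"
      by (rule filterlim_compose[OF filterlim_uminus_at_top_at_bot ln_at_0])
    have "((\<lambda>u::real. ln (1 - u)) \<longlongrightarrow> ln (1 - 0)) (at_right 0)"
      by (intro tendsto_intros) auto
    from filterlim_tendsto_add_at_top[OF this ln0] have "filterlim g at_bot (at_right 0)"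
      by (simp add: filterlim_uminus_at_top g_def[abs_def])
    moreover have "filterlim (\<lambda>u::real. 1 - u) (at_right 0) (at_left 1)"
      unfolding filterlim_at
      by (intro conjI tendsto_eq_intros) (auto simp: eventually_at_filter)
    from filterlim_compose[OF ln0 this]
    have "LIM u at_left 1. - ln (1 - u) :> (at_top :: real filter)" .
    moreover have "((\<lambda>u::real. ln u) \<longlongrightarrow> ln 1) (at_left 1)"
      by (intro tendsto_intros) auto
    ultimately have "filterlim g at_bot (at_right 0)" "filterlim g at_top (at_left 1)"
      using filterlim_tendsto_add_at_top[of ln "ln 1" "at_left 1" "\<lambda>u. - ln (1 - u)"]
      by (simp_all add: g_def[abs_def])
    then show "((ereal \<circ> g \<circ> real_of_ereal) \<longlongrightarrow> - \<infinity>) (at_right 0)"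
      "((ereal \<circ> g \<circ> real_of_ereal) \<longlongrightarrow> \<infinity>) (at_left 1)"
      unfolding zero_ereal_def one_ereal_def
      by (simp_all add: ereal_tendsto_simps)
  qed
  have g1: "DERIV g u :> g' u" "isCont f (g u)" "isCont g' u" "0 \<le> f (g u)" if "0 < ereal u" "ereal u < 1" for u
  proof -
    have u: "0 < u" "u < 1" using that by auto
    show "DERIV g u :> g' u"
      unfolding g_def g'_def using u by (auto intro!: derivative_eq_intros simp: field_simps)
    show "isCont f (g u)" unfolding f_def using cosh1[of "g u"] by (intro continuous_intros) auto
    show "isCont g' u" unfolding g'_def using u by (intro continuous_intros) auto
    show "0 \<le> f (g u)" unfolding f_def using cosh1[of "g u"] by simp
  qed
  have g2: "0 \<le> g' u" if "0 \<le> ereal u" "ereal u \<le> 1" for u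
    using that by (auto simp: g'_def)
  note sub = interval_integral_substitution_nonneg[where a = 0 and b = 1 and g = g and g' = g' and f = f,
      OF _ g1(1) g1(2) g1(3) g1(4) g2 lim int, simplified]
  have f0: "f t \<ge> 0" for t using cosh1[of t] by (simp add: f_def)
  have iR: "integrable lborel f" using sub(1) by (simp add: set_integrable_def)
  have "(\<integral>\<^sup>+t. ennreal (f t) \<partial>lborel) = ennreal (LINT t|lborel. f t)"
    using iR f0 by (intro nn_integral_eq_integral) auto
  also have "(LINT t|lborel. f t) = (LBINT x=0..1. f (g x) * g' x)"
    unfolding sub(2)[symmetric] by (simp add: interval_lebesgue_integral_def set_lebesgue_integral_def)
  also have "\<dots> = 2 * (pi * s / sin (pi * s))"
  proof -
    have "(LBINT x=0..1. f (g x) * g' x) = enn2real (\<integral>\<^sup>+u. ennreal (indicator {0<..<1} u *\<^sub>R (f (g u) * g' u)) \<partial>lborel)"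
      unfolding interval_lebesgue_integral_def set_lebesgue_integral_def ei
      using integral_eq_nn_integral[OF meas nonneg] by simp
    moreover have "sin (pi * s) > 0" using assms by (intro sin_gt_zero) auto
    ultimately show ?thesis using assms unfolding nn' by simp
  qed
  finally show ?thesis by (simp add: f_def)
qed

text \<open>Folding the integral over the whole line at 0 pairs exp(st) with exp(-st).\<close>

lemma nn_integral_cosh_ratio:
  fixes s :: real
  assumes "0 < s" "s < 1"
  shows "(\<integral>\<^sup>+t\<in>{0<..}. ennreal (cosh (s * t) / (1 + cosh t)) \<partial>lborel) = ennreal (pi * s / sin (pi * s))"
proof -
  define f where "f t = exp (s * t) / (1 + cosh t)" for t :: real
  have cosh1: "1 + cosh t > 0" for t :: real using cosh_real_pos[of t] by linarith
  have f0: "f t \<ge> 0" for t using cosh1[of t] by (simp add: f_def)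
  have [measurable]: "f \<in> borel_measurable borel" unfolding f_def by measurable
  let ?X = "\<integral>\<^sup>+t\<in>{0<..}. ennreal (cosh (s * t) / (1 + cosh t)) \<partial>lborel"
  have neg: "(\<integral>\<^sup>+t\<in>{..<0}. ennreal (f t) \<partial>lborel) = (\<integral>\<^sup>+t\<in>{0<..}. ennreal (f (- t)) \<partial>lborel)"
    using nn_integral_real_affine[of "\<lambda>t. ennreal (f t) * indicator {..<0} t" "- 1" 0]
    by (simp add: indicator_def)
  have "ennreal (2 * (pi * s / sin (pi * s))) = (\<integral>\<^sup>+t. ennreal (f t) \<partial>lborel)"
    using nn_integral_exp_cosh[OF assms] by (simp add: f_def)
  also have "\<dots> = (\<integral>\<^sup>+t. ennreal (f t) * indicator {0<..} t + ennreal (f t) * indicator {..<0} t \<partial>lborel)"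
    by (rule nn_integral_cong_AE) (use AE_lborel_singleton[of 0] in eventually_elim, auto simp: indicator_def)
  also have "\<dots> = (\<integral>\<^sup>+t\<in>{0<..}. ennreal (f t) \<partial>lborel) + (\<integral>\<^sup>+t\<in>{0<..}. ennreal (f (- t)) \<partial>lborel)"
    by (subst nn_integral_add) (auto simp: neg)
  also have "\<dots> = (\<integral>\<^sup>+t. ennreal (f t) * indicator {0<..} t + ennreal (f (- t)) * indicator {0<..} t \<partial>lborel)"
    by (subst nn_integral_add) auto
  also have "\<dots> = (\<integral>\<^sup>+t. 2 * (ennreal (cosh (s * t) / (1 + cosh t)) * indicator {0<..} t) \<partial>lborel)"
  proof (intro nn_integral_cong)
    fix t :: real
    have eq: "f t + f (- t) = 2 * (cosh (s * t) / (1 + cosh t))"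
    proof -
      have "f t + f (- t) = (exp (s * t) + exp (- (s * t))) / (1 + cosh t)"
        by (simp add: f_def add_divide_distrib)
      also have "exp (s * t) + exp (- (s * t)) = 2 * cosh (s * t)" by (simp add: cosh_field_def)
      finally show ?thesis by simp
    qed
    have "ennreal (f t) + ennreal (f (- t)) = 2 * ennreal (cosh (s * t) / (1 + cosh t))"
    proof -
      have "ennreal (f t) + ennreal (f (- t)) = ennreal (2 * (cosh (s * t) / (1 + cosh t)))"
        using eq f0 by (metis ennreal_plus)
      also have "\<dots> = 2 * ennreal (cosh (s * t) / (1 + cosh t))"
        by (subst ennreal_mult') auto
      finally show ?thesis .
    qed
    then show "ennreal (f t) * indicator {0<..} t + ennreal (f (- t)) * indicator {0<..} t =
        2 * (ennreal (cosh (s * t) / (1 + cosh t)) * indicator {0<..} t)"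
      by (simp add: indicator_def)
  qed
  also have "\<dots> = 2 * ?X" by (rule nn_integral_cmult) measurable
  also have "ennreal (2 * (pi * s / sin (pi * s))) = 2 * ennreal (pi * s / sin (pi * s))"
    by (subst ennreal_mult') auto
  finally have "2 * ?X = 2 * ennreal (pi * s / sin (pi * s))" by (rule sym)
  then show ?thesis by (simp add: ennreal_mult_cancel_left)
qed

section \<open>The integral of the kernel\<close>

text \<open>The \<theta>-independent factor of the integrand. Its integral over t > 0 will be the
  limit of \<open>F_exponent\<close> for Re \<theta> to infinity.\<close>

definition F_kernel :: "real \<Rightarrow> real \<Rightarrow> real" where
  "F_kernel \<nu> t = (cosh (t / 2) - cosh ((1 / 2 + \<nu>) * t)) / (t * cosh (t / 2) * sinh t)"

lemma measurable_F_kernel [measurable]: "F_kernel \<nu> \<in> borel_measurable borel"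
  unfolding F_kernel_def by measurable

text \<open>The difference of the hyperbolic cosines is a product of hyperbolic sines; one of them
  supplies a factor t that cancels the 1/t at 0.\<close>

lemma F_kernel_bounds:
  assumes "0 < \<nu>" "\<nu> < 1" "t > 0"
  shows "F_kernel \<nu> t \<le> 0" and "- F_kernel \<nu> t \<le> 2 * \<nu> * exp (- (1 - \<nu>) * t)"
proof -
  \<comment> \<open>The mean of the two frequencies 1/2 + \<nu> and 1/2; it is less than 1.\<close>
  define c where "c = (1 + \<nu>) / 2"
  have sinh_pos: "sinh t > 0" using assms by simp
  have sinh_le: "sinh u \<le> u * exp u" if "u \<ge> 0" for u :: real
  proof -
    have "sinh u = exp u * (1 - exp (- 2 * u)) / 2"
      by (simp add: sinh_field_def right_diff_distrib exp_add[symmetric])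
    also have "\<dots> \<le> exp u * (2 * u) / 2"
      using exp_ge_add_one_self[of "- 2 * u"] by (intro divide_right_mono mult_left_mono) auto
    finally show ?thesis by (simp add: mult.commute)
  qed
  have ratio: "sinh (c * t) \<le> exp (- (1 - c) * t) * sinh t"
  proof -
    have "sinh (c * t) = exp (c * t) * (1 - exp (- 2 * (c * t))) / 2"
      by (simp add: sinh_field_def right_diff_distrib exp_add[symmetric])
    also have "\<dots> \<le> exp (c * t) * (1 - exp (- 2 * t)) / 2"
      using assms by (intro divide_right_mono mult_left_mono) (auto simp: c_def)
    also have "\<dots> = exp (- (1 - c) * t) * sinh t"
      by (simp add: sinh_field_def right_diff_distrib exp_add[symmetric] algebra_simps)
    finally show ?thesis .
  qed
  have "1 / cosh (t / 2) \<le> 2 * exp (- (t / 2))"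
    using cosh_real_pos[of "t / 2"] by (simp add: cosh_field_def exp_minus field_simps)
  then have cosh_le: "1 \<le> 2 * exp (- (t / 2)) * cosh (t / 2)"
    using cosh_real_pos[of "t / 2"] by (simp add: field_simps)
  have diff: "cosh ((1 / 2 + \<nu>) * t) - cosh (t / 2) = 2 * sinh (c * t) * sinh (\<nu> * t / 2)"
  proof -
    have "(1 / 2 + \<nu>) * t = c * t + \<nu> * t / 2" "t / 2 = c * t - \<nu> * t / 2"
      by (simp_all add: c_def field_simps)
    then show ?thesis by (simp only: cosh_add cosh_diff)
  qed
  have eq: "- F_kernel \<nu> t = 2 * sinh (c * t) * sinh (\<nu> * t / 2) / (t * cosh (t / 2) * sinh t)"
    unfolding diff[symmetric] F_kernel_def by (simp add: minus_divide_left)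
  have pos: "sinh (c * t) \<ge> 0" "sinh (\<nu> * t / 2) \<ge> 0" using assms by (auto simp: c_def)
  have "- F_kernel \<nu> t \<ge> 0"
    unfolding eq using pos assms sinh_pos cosh_real_nonneg[of "t / 2"] by simp
  then show "F_kernel \<nu> t \<le> 0" by simp
  have u: "sinh (\<nu> * t / 2) \<le> \<nu> * t / 2 * exp (\<nu> * t / 2)" using assms by (intro sinh_le) simp
  have nonneg: "0 \<le> exp (- (1 - c) * t) * sinh t" "0 \<le> \<nu> * t / 2 * exp (\<nu> * t / 2)"
    using assms sinh_pos by simp_all
  have "2 * sinh (c * t) * sinh (\<nu> * t / 2) \<le>
      2 * (exp (- (1 - c) * t) * sinh t) * (\<nu> * t / 2 * exp (\<nu> * t / 2))" (is "?l \<le> ?r")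
    by (rule mult_mono[OF mult_left_mono[OF ratio] u _ pos(2)]) (use nonneg(1) in simp_all)
  also have "?r \<le> ?r * (2 * exp (- (t / 2)) * cosh (t / 2))"
  proof -
    have "0 \<le> ?r" by (rule mult_nonneg_nonneg[OF mult_nonneg_nonneg[OF _ nonneg(1)] nonneg(2)]) simp
    from mult_left_mono[OF cosh_le this] show ?thesis by (simp only: mult_1_right)
  qed
  also have "\<dots> = 2 * \<nu> * (exp (- (1 - c) * t) * exp (\<nu> * t / 2) * exp (- (t / 2))) * (t * cosh (t / 2) * sinh t)"
    by simp
  also have "exp (- (1 - c) * t) * exp (\<nu> * t / 2) * exp (- (t / 2)) = exp (- (1 - \<nu>) * t)"
    by (simp add: exp_add[symmetric] c_def field_simps)
  finally show "- F_kernel \<nu> t \<le> 2 * \<nu> * exp (- (1 - \<nu>) * t)"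
    unfolding eq using assms sinh_pos cosh_real_pos[of "t / 2"] by (simp add: pos_divide_le_eq)
qed

lemma nn_integral_F_kernel_finite:
  assumes "0 < \<nu>" "\<nu> < 1"
  shows "(\<integral>\<^sup>+t\<in>{0<..}. ennreal (- F_kernel \<nu> t) \<partial>lborel) < \<infinity>"
proof -
  have "(\<integral>\<^sup>+t\<in>{0<..}. ennreal (- F_kernel \<nu> t) \<partial>lborel) \<le>
      (\<integral>\<^sup>+t. ennreal (2 * \<nu>) * (ennreal (exp (- (1 - \<nu>) * t)) * indicator {0<..} t) \<partial>lborel)"
    using F_kernel_bounds(2)[OF assms] assms
    by (intro nn_integral_mono) (auto simp: indicator_def ennreal_mult[symmetric])
  also have "\<dots> = ennreal (2 * \<nu>) * ennreal (exp (- (1 - \<nu>) * 0) / (1 - \<nu>))"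
    using assms by (subst nn_integral_cmult) (auto simp: nn_integral_exp_greaterThan[of "1 - \<nu>" 0, simplified])
  also have "\<dots> < \<infinity>" by (simp add: ennreal_mult_less_top)
  finally show ?thesis .
qed

text \<open>The negative kernel vanishes at \<nu> = 0, hence it is the integral of its derivative in
  \<nu>, and Tonelli allows the t-integration to be done first.\<close>

lemma nn_integral_F_kernel:
  assumes "0 < \<nu>" "\<nu> < 1"
  shows "(\<integral>\<^sup>+t\<in>{0<..}. ennreal (- F_kernel \<nu> t) \<partial>lborel) =
    (\<integral>\<^sup>+s\<in>{0<..<\<nu>}. ennreal (pi * s / sin (pi * s)) \<partial>lborel)
    + (\<integral>\<^sup>+s\<in>{0<..<\<nu>}. ennreal (pi / 2 * tan (pi * s / 2)) \<partial>lborel)"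
proof -
  \<comment> \<open>The derivative of \<open>- F_kernel s t\<close> in s; the inner derivative t
    cancels the 1/t.\<close>
  define k where "k s t = sinh ((1 / 2 + s) * t) / (cosh (t / 2) * sinh t)" for s t :: real
  have [measurable]: "(\<lambda>(s, t). k s t) \<in> borel_measurable (borel \<Otimes>\<^sub>M borel)"
    "\<And>t. (\<lambda>s. k s t) \<in> borel_measurable borel" "k s \<in> borel_measurable borel" for s
    unfolding k_def by measurable
  have inner: "ennreal (- F_kernel \<nu> t) = (\<integral>\<^sup>+s. ennreal (k s t) * indicator {0..\<nu>} s \<partial>lborel)" if t: "t > 0" for t
  proof -
    have nz: "t * (cosh (t / 2) * sinh t) \<noteq> 0" using t cosh_real_pos[of "t / 2"] by auto
    have "(\<integral>\<^sup>+s. ennreal (k s t) * indicator {0..\<nu>} s \<partial>lborel) =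
        ennreal (cosh ((1 / 2 + \<nu>) * t) / (t * (cosh (t / 2) * sinh t)) - cosh ((1 / 2 + 0) * t) / (t * (cosh (t / 2) * sinh t)))"
    proof (rule nn_integral_FTC_Icc)
      fix s assume s: "s \<in> {0..\<nu>}"
      have "((\<lambda>s. cosh ((1 / 2 + s) * t) / (t * (cosh (t / 2) * sinh t))) has_real_derivative
          sinh ((1 / 2 + s) * t) * t / (t * (cosh (t / 2) * sinh t))) (at s)"
        by (auto intro!: derivative_eq_intros)
      then show "((\<lambda>s. cosh ((1 / 2 + s) * t) / (t * (cosh (t / 2) * sinh t))) has_real_derivative k s t) (at s)"
        using t by (simp add: k_def)
      show "0 \<le> k s t" unfolding k_def using s t cosh_real_nonneg[of "t / 2"] by auto
    qed (use assms in auto)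
    also have "cosh ((1 / 2 + \<nu>) * t) / (t * (cosh (t / 2) * sinh t)) - cosh ((1 / 2 + 0) * t) / (t * (cosh (t / 2) * sinh t))
        = - F_kernel \<nu> t"
      unfolding diff_divide_distrib[symmetric] F_kernel_def by (simp add: minus_divide_left mult.assoc)
    finally show ?thesis by simp
  qed
  \<comment> \<open>Addition theorem for t/2 + st, with sinh t = 2 sinh(t/2) cosh(t/2) and 1 + cosh
    t = 2 cosh(t/2)^2. Each summand has a closed integral.\<close>
  have split: "k s t = cosh (s * t) / (1 + cosh t) + sinh (s * t) / sinh t" if "t > 0" for s t
  proof -
    have t2: "t = 2 * (t / 2)" by simp
    have st: "sinh t = 2 * sinh (t / 2) * cosh (t / 2)" by (subst t2) (rule sinh_double)
    have ct: "1 + cosh t = 2 * (cosh (t / 2))\<^sup>2" using cosh_double_cosh[of "t / 2"] by simp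
    have nz: "sinh (t / 2) \<noteq> 0" "cosh (t / 2) \<noteq> 0" using that by auto
    have "k s t = (sinh (t / 2) * cosh (s * t) + cosh (t / 2) * sinh (s * t)) / (cosh (t / 2) * sinh t)"
    proof -
      have "(1 / 2 + s) * t = t / 2 + s * t" by (simp add: field_simps)
      then show ?thesis unfolding k_def by (simp only: sinh_add)
    qed
    then show ?thesis unfolding ct st using nz by (simp add: divide_simps power2_eq_square)
  qed
  have outer: "(\<integral>\<^sup>+t. ennreal (k s t) * indicator {0<..} t \<partial>lborel) =
      ennreal (pi * s / sin (pi * s)) + ennreal (pi / 2 * tan (pi * s / 2))" if "s \<in> {0<..<\<nu>}" for s
  proof -
    have "(\<integral>\<^sup>+t. ennreal (k s t) * indicator {0<..} t \<partial>lborel) =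
       (\<integral>\<^sup>+t. ennreal (cosh (s * t) / (1 + cosh t)) * indicator {0<..} t + ennreal (sinh (s * t) / sinh t) * indicator {0<..} t \<partial>lborel)"
    proof (intro nn_integral_cong)
      fix t :: real
      show "ennreal (k s t) * indicator {0<..} t =
        ennreal (cosh (s * t) / (1 + cosh t)) * indicator {0<..} t + ennreal (sinh (s * t) / sinh t) * indicator {0<..} t"
      proof (cases "t > 0")
        case True
        then have "0 \<le> cosh (s * t) / (1 + cosh t)" "0 \<le> sinh (s * t) / sinh t"
          using that cosh_real_nonneg[of t] by (auto intro!: divide_nonneg_nonneg)
        then show ?thesis using True by (simp add: split[OF True] ennreal_plus)
      qed simp
    qed
    also have "\<dots> = (\<integral>\<^sup>+t\<in>{0<..}. ennreal (cosh (s * t) / (1 + cosh t)) \<partial>lborel)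
        + (\<integral>\<^sup>+t\<in>{0<..}. ennreal (sinh (s * t) / sinh t) \<partial>lborel)"
      by (rule nn_integral_add) measurable
    also have "\<dots> = ennreal (pi * s / sin (pi * s)) + ennreal (pi / 2 * tan (pi * s / 2))"
      using that assms by (subst nn_integral_cosh_ratio nn_integral_sinh_ratio, simp, simp)+ simp
    finally show ?thesis .
  qed
  have "(\<integral>\<^sup>+t\<in>{0<..}. ennreal (- F_kernel \<nu> t) \<partial>lborel) =
      (\<integral>\<^sup>+t. \<integral>\<^sup>+s. ennreal (k s t) * indicator {0<..} t * indicator {0..\<nu>} s \<partial>lborel \<partial>lborel)"
    by (intro nn_integral_cong) (auto simp: indicator_def inner)
  also have "\<dots> = (\<integral>\<^sup>+s. \<integral>\<^sup>+t. ennreal (k s t) * indicator {0<..} t * indicator {0..\<nu>} s \<partial>lborel \<partial>lborel)"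
    by (rule lborel_pair.Fubini') measurable
  also have "\<dots> = (\<integral>\<^sup>+s. ennreal (pi * s / sin (pi * s)) * indicator {0<..<\<nu>} s
      + ennreal (pi / 2 * tan (pi * s / 2)) * indicator {0<..<\<nu>} s \<partial>lborel)"
  proof (rule nn_integral_cong_AE)
    show "AE s in lborel. (\<integral>\<^sup>+t. ennreal (k s t) * indicator {0<..} t * indicator {0..\<nu>} s \<partial>lborel) =
      ennreal (pi * s / sin (pi * s)) * indicator {0<..<\<nu>} s + ennreal (pi / 2 * tan (pi * s / 2)) * indicator {0<..<\<nu>} s"
      using AE_lborel_singleton[of 0] AE_lborel_singleton[of \<nu>]
    proof eventually_elim
      case (elim s)
      show ?case
      proof (cases "s \<in> {0<..<\<nu>}")
        case True
        then show ?thesis using outer[OF True] by (simp add: indicator_def)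
      next
        case False
        then have "s \<notin> {0..\<nu>}" using elim by auto
        then have "indicator {0..\<nu>} s = (0 :: ennreal)" "indicator {0<..<\<nu>} s = (0 :: ennreal)"
          using False by (simp_all only: indicator_simps not_False_eq_True)
        then show ?thesis by simp
      qed
    qed
  qed
  also have "\<dots> = (\<integral>\<^sup>+s\<in>{0<..<\<nu>}. ennreal (pi * s / sin (pi * s)) \<partial>lborel)
    + (\<integral>\<^sup>+s\<in>{0<..<\<nu>}. ennreal (pi / 2 * tan (pi * s / 2)) \<partial>lborel)"
    by (rule nn_integral_add) (unfold tan_def, measurable)
  finally show ?thesis .
qed

lemma nn_integral_tan:
  assumes "0 < \<nu>" "\<nu> < 1"
  shows "(\<integral>\<^sup>+s\<in>{0<..<\<nu>}. ennreal (pi / 2 * tan (pi * s / 2)) \<partial>lborel) = ennreal (- ln (cos (pi * \<nu> / 2)))"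
proof -
  have "(\<integral>\<^sup>+s\<in>{0<..<\<nu>}. ennreal (pi / 2 * tan (pi * s / 2)) \<partial>lborel)
     = (\<integral>\<^sup>+s. ennreal (pi / 2 * tan (pi * s / 2)) * indicator {0..\<nu>} s \<partial>lborel)"
    by (rule nn_integral_cong_AE)
      (use AE_lborel_singleton[of 0] AE_lborel_singleton[of \<nu>] in eventually_elim, auto simp: indicator_def)
  also have "\<dots> = ennreal (- ln (cos (pi * \<nu> / 2)) - - ln (cos (pi * 0 / 2)))"
  proof (rule nn_integral_FTC_Icc)
    show "(\<lambda>s. pi / 2 * tan (pi * s / 2)) \<in> borel_measurable borel" unfolding tan_def by measurable
    fix s assume s: "s \<in> {0..\<nu>}"
    have s2: "0 \<le> pi * s / 2" "pi * s / 2 < pi / 2" using s assms by auto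
    then have c: "cos (pi * s / 2) > 0" by (intro cos_gt_zero_pi) (use pi_gt_zero in linarith)+
    have "sin (pi * s / 2) \<ge> 0" using s2 by (intro sin_ge_zero) auto
    then show "0 \<le> pi / 2 * tan (pi * s / 2)" using c by (auto simp: tan_def)
    show "((\<lambda>s. - ln (cos (pi * s / 2))) has_real_derivative pi / 2 * tan (pi * s / 2)) (at s)"
      using c by (auto intro!: derivative_eq_intros simp: tan_def field_simps)
  qed (use assms in auto)
  finally show ?thesis by simp
qed

text \<open>The tangent integrates to -ln cos, which gives the cosine. The integral of pi s / sin(pi
  s) is kept and becomes the one in \<open>Z_phi\<close> by the substitution t = pi s.\<close>

lemma exp_integral_F_kernel:
  assumes "0 < \<nu>" "\<nu> < 1"
  shows "exp (LINT t:{0<..}|lborel. F_kernel \<nu> t) =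
    cos (pi * \<nu> / 2) * exp (- (1 / pi) * (LBINT t=0..pi * \<nu>. t / sin t))"
proof -
  define X where "X = (\<integral>\<^sup>+s\<in>{0<..<\<nu>}. ennreal (pi * s / sin (pi * s)) \<partial>lborel)"
  define W where "W = (\<integral>\<^sup>+t\<in>{0<..}. ennreal (- F_kernel \<nu> t) \<partial>lborel)"
  have c: "0 < cos (pi * \<nu> / 2)" using assms by (intro cos_gt_zero) auto
  have W: "W = X + ennreal (- ln (cos (pi * \<nu> / 2)))"
    using nn_integral_F_kernel[OF assms] nn_integral_tan[OF assms] by (simp add: X_def W_def)
  \<comment> \<open>Finiteness of the total passes to its summand; without it
    \<open>enn2real\<close> would not be additive.\<close>
  then have X: "X < \<infinity>" using nn_integral_F_kernel_finite[OF assms] by (auto simp: W_def[symmetric])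
  have "(LINT t:{0<..}|lborel. - F_kernel \<nu> t) = enn2real W"
  proof -
    have "(LINT t:{0<..}|lborel. - F_kernel \<nu> t) = enn2real (\<integral>\<^sup>+t. ennreal (indicator {0<..} t *\<^sub>R (- F_kernel \<nu> t)) \<partial>lborel)"
      unfolding set_lebesgue_integral_def
      by (rule integral_eq_nn_integral) (use F_kernel_bounds(1)[OF assms] in \<open>auto simp: indicator_def intro!: AE_I2\<close>)
    also have "(\<integral>\<^sup>+t. ennreal (indicator {0<..} t *\<^sub>R (- F_kernel \<nu> t)) \<partial>lborel) = W"
      unfolding W_def by (intro nn_integral_cong) (auto simp: indicator_def)
    finally show ?thesis .
  qed
  then have I: "(LINT t:{0<..}|lborel. F_kernel \<nu> t) = - enn2real X + ln (cos (pi * \<nu> / 2))"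
    unfolding W using X c by (simp add: set_lebesgue_integral_def enn2real_plus)
  have "(LBINT t=0..pi * \<nu>. t / sin t) = enn2real (\<integral>\<^sup>+t. ennreal (indicator {0<..<pi * \<nu>} t *\<^sub>R (t / sin t)) \<partial>lborel)"
  proof -
    have "0 \<le> t / sin t" if "0 < t" "t < pi * \<nu>" for t
    proof -
      have "pi * \<nu> < pi * 1" using assms by (intro mult_strict_left_mono) auto
      then have "t < pi" using that by linarith
      then show ?thesis using that sin_gt_zero[of t] by simp
    qed
    then have sin: "0 < t \<longrightarrow> t < pi * \<nu> \<longrightarrow> 0 \<le> t / sin t" for t by blast
    have "(LBINT t=0..pi * \<nu>. t / sin t) = (LINT t:{0<..<pi * \<nu>}|lborel. t / sin t)"
      using assms by (simp add: interval_lebesgue_integral_def zero_ereal_def)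
    then show ?thesis
      unfolding set_lebesgue_integral_def
      by (subst (asm) integral_eq_nn_integral) (use sin in \<open>auto simp: indicator_def intro!: AE_I2\<close>)
  qed
  also have "(\<integral>\<^sup>+t. ennreal (indicator {0<..<pi * \<nu>} t *\<^sub>R (t / sin t)) \<partial>lborel) = ennreal pi * X"
    unfolding X_def
    by (subst nn_integral_real_affine[where c = pi and t = 0]) 
      (auto simp: indicator_def zero_less_mult_iff intro!: arg_cong[where f = "\<lambda>x. ennreal pi * x"] nn_integral_cong)
  finally have "(LBINT t=0..pi * \<nu>. t / sin t) = pi * enn2real X"
    by (simp add: enn2real_mult)
  then have "- (1 / pi) * (LBINT t=0..pi * \<nu>. t / sin t) = - enn2real X" by simp
  moreover have "exp (- enn2real X + ln (cos (pi * \<nu> / 2))) = cos (pi * \<nu> / 2) * exp (- enn2real X)"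
    unfolding exp_add using c by simp
  ultimately show ?thesis unfolding I by (simp only:)
qed

section \<open>The value of F at i pi\<close>

lemma integrable_exp_greaterThan:
  fixes a c M :: real assumes "c > 0"
  shows "integrable lborel (\<lambda>t. indicator {a<..} t *\<^sub>R (M * exp (- c * t)))"
proof -
  have "integrable lborel (\<lambda>t. exp (- c * t) * indicator {a<..} t)"
  proof (rule integrableI_nonneg)
    have "(\<integral>\<^sup>+t. ennreal (exp (- c * t) * indicator {a<..} t) \<partial>lborel) = ennreal (exp (- c * a) / c)"
      unfolding nn_integral_exp_greaterThan[OF assms, symmetric]
      by (intro nn_integral_cong) (auto simp: indicator_def)
    then show "(\<integral>\<^sup>+t. ennreal (exp (- c * t) * indicator {a<..} t) \<partial>lborel) < \<infinity>"
      by (simp only: ennreal_less_top infinity_ennreal_def)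
  qed auto
  then have "integrable lborel (\<lambda>t. M * (exp (- c * t) * indicator {a<..} t))"
    by (rule integrable_mult_right)
  then show ?thesis by (simp add: mult_ac)
qed

text \<open>A shift by half a period \<open>\<delta>\<close> changes the sign of the oscillating factor, so twice the integral is
  bounded by the \<open>L\<^sup>1\<close> distance between \<open>g\<close> and its translate by \<open>\<delta>\<close>.\<close>

lemma Riemann_Lebesgue_greaterThan:
  fixes g :: "real \<Rightarrow> complex"
  assumes [measurable]: "g \<in> borel_measurable borel"
    and cont: "\<And>t. t > 0 \<Longrightarrow> isCont g t"
    and bound: "\<And>t. t > 0 \<Longrightarrow> norm (g t) \<le> M * exp (- \<epsilon> * t)"
    and "\<epsilon> > 0" "\<kappa> \<noteq> 0"
  shows "((\<lambda>x. LINT t:{0<..}|lborel. g t * cis (\<kappa> * x * t)) \<longlongrightarrow> 0) at_top"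
proof -
  define G where "G t = indicator {0<..} t *\<^sub>R g t" for t :: real
  \<comment> \<open>Dominates \<open>G\<close> plus its translate when 0 < \<delta> < 1: the
    translate starts at -\<delta> > -1, and each of the two is at most M exp(-\<epsilon> t).\<close>
  define w where "w t = indicator {-1<..} t *\<^sub>R (2 * M * exp (- \<epsilon> * t))" for t :: real
  define \<delta> where "\<delta> x = pi / (\<bar>\<kappa>\<bar> * x)" for x :: real
  have [measurable]: "G \<in> borel_measurable borel" unfolding G_def by measurable
  have M: "M \<ge> 0"
  proof -
    have "0 \<le> M * exp (- \<epsilon> * 1)" using bound[of 1] norm_ge_zero[of "g 1"] by linarith
    then show ?thesis by (simp add: zero_le_mult_iff)
  qed
  have norm_G: "norm (G t) \<le> M * exp (- \<epsilon> * t)" for t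
    using bound[of t] M by (auto simp: G_def indicator_def)
  have int_G: "integrable lborel G"
  proof (rule Bochner_Integration.integrable_bound)
    show "integrable lborel (\<lambda>t. indicator {0<..} t *\<^sub>R (M * exp (- \<epsilon> * t)))"
      using assms(4) by (rule integrable_exp_greaterThan)
    show "AE t in lborel. norm (G t) \<le> norm (indicator {0<..} t *\<^sub>R (M * exp (- \<epsilon> * t)))"
      using bound M by (intro AE_I2) (auto simp: G_def indicator_def)
  qed measurable
  have cont_G: "isCont G t" if "t \<noteq> 0" for t
  proof (cases "t > 0")
    case True
    have "\<forall>\<^sub>F y in nhds t. y \<in> {0<..}" using True by (intro eventually_nhds_in_open) auto
    then have "\<forall>\<^sub>F y in nhds t. G y = g y" by eventually_elim (simp add: G_def)
    then show ?thesis using cont[OF True] isCont_cong by blast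
  next
    case False
    then have "t < 0" using that by simp
    then have "\<forall>\<^sub>F y in nhds t. y \<in> {..<0}" by (intro eventually_nhds_in_open) auto
    then have "\<forall>\<^sub>F y in nhds t. G y = 0" by eventually_elim (simp add: G_def)
    then have "isCont G t \<longleftrightarrow> isCont (\<lambda>_. 0 :: complex) t" by (rule isCont_cong)
    then show ?thesis by simp
  qed
  have \<delta>_lim: "(\<delta> \<longlongrightarrow> 0) at_top"
  proof -
    have "((\<lambda>x. pi / \<bar>\<kappa>\<bar> * inverse x) \<longlongrightarrow> pi / \<bar>\<kappa>\<bar> * 0) at_top"
      by (intro tendsto_intros tendsto_inverse_0_at_top filterlim_ident)
    then show ?thesis by (simp add: \<delta>_def[abs_def] field_simps)
  qed
  have \<delta>_small: "\<forall>\<^sub>F x in at_top. 0 < \<delta> x \<and> \<delta> x < 1"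
  proof -
    have "\<forall>\<^sub>F x in at_top. \<delta> x < 1" using \<delta>_lim by (rule order_tendstoD) simp
    moreover have "\<forall>\<^sub>F x in at_top. (0::real) < x" by (rule eventually_gt_at_top)
    ultimately show ?thesis by eventually_elim (use assms(5) in \<open>simp add: \<delta>_def\<close>)
  qed
  have "((\<lambda>x. LINT t|lborel. norm (G t - G (t + \<delta> x))) \<longlongrightarrow> (LINT t::real|lborel. (0::real))) at_top"
  proof (rule integral_dominated_convergence_at_top[where w = w])
    show "integrable lborel w" unfolding w_def using assms(4) by (rule integrable_exp_greaterThan)
    show "AE t in lborel. ((\<lambda>x. norm (G t - G (t + \<delta> x))) \<longlongrightarrow> 0) at_top"
      using AE_lborel_singleton[of 0]
    proof eventually_elim
      case (elim t)
      have "((\<lambda>x. t + \<delta> x) \<longlongrightarrow> t + 0) at_top" by (intro tendsto_intros \<delta>_lim)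
      then have "((\<lambda>x. G (t + \<delta> x)) \<longlongrightarrow> G t) at_top"
        using isCont_tendsto_compose[OF cont_G] elim by simp
      then have "((\<lambda>x. norm (G t - G (t + \<delta> x))) \<longlongrightarrow> norm (G t - G t)) at_top"
        by (intro tendsto_intros)
      then show ?case by simp
    qed
    show "\<forall>\<^sub>F x in at_top. AE t in lborel. norm (norm (G t - G (t + \<delta> x))) \<le> w t"
      using \<delta>_small
    proof eventually_elim
      case (elim x)
      show ?case
      proof (intro AE_I2)
        fix t
        show "norm (norm (G t - G (t + \<delta> x))) \<le> w t"
        proof (cases "t > - 1")
          case True
          have "norm (G t - G (t + \<delta> x)) \<le> norm (G t) + norm (G (t + \<delta> x))" by (rule norm_triangle_ineq4)
          also have "\<dots> \<le> M * exp (- \<epsilon> * t) + M * exp (- \<epsilon> * (t + \<delta> x))" by (intro add_mono norm_G)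
          also have "M * exp (- \<epsilon> * (t + \<delta> x)) \<le> M * exp (- \<epsilon> * t)"
            using M assms(4) elim by (intro mult_left_mono) (auto simp: algebra_simps)
          finally show ?thesis using True by (simp add: w_def)
        next
          case False
          then show ?thesis using elim by (simp add: G_def w_def)
        qed
      qed
    qed
  qed measurable
  then have lim: "((\<lambda>x. LINT t|lborel. norm (G t - G (t + \<delta> x))) \<longlongrightarrow> 0) at_top" by simp
  have "\<forall>\<^sub>F x in at_top. norm (LINT t|lborel. G t * cis (\<kappa> * x * t)) \<le> (LINT t|lborel. norm (G t - G (t + \<delta> x)))"
    using eventually_gt_at_top[of 0]
  proof eventually_elim
    case (elim x)
    let ?I = "LINT t|lborel. G t * cis (\<kappa> * x * t)"
    have int_shift: "integrable lborel (\<lambda>t. G (t + \<delta> x))"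
      using lborel_integrable_real_affine[OF int_G, of 1 "\<delta> x"] by (simp add: add.commute)
    have int_cis: "integrable lborel (\<lambda>t. H t * cis (\<kappa> * x * t))" if "integrable lborel H" for H :: "real \<Rightarrow> complex"
    proof (rule Bochner_Integration.integrable_bound[OF that])
      have [measurable]: "H \<in> borel_measurable borel" using that by auto
      have [measurable]: "(\<lambda>t. cis (\<kappa> * x * t)) \<in> borel_measurable borel"
        by (intro borel_measurable_continuous_onI continuous_intros)
      show "(\<lambda>t. H t * cis (\<kappa> * x * t)) \<in> borel_measurable lborel" by measurable
    qed (simp add: norm_mult)
    have "\<kappa> * x * \<delta> x = pi \<or> \<kappa> * x * \<delta> x = - pi"
      using elim assms(5) by (auto simp: \<delta>_def abs_if)
    then have "cis (\<kappa> * x * (t + \<delta> x)) = - cis (\<kappa> * x * t)" for t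
      by (auto simp: complex_eq_iff distrib_left cos_add sin_add)
    moreover have "?I = (LINT t|lborel. G (t + \<delta> x) * cis (\<kappa> * x * (t + \<delta> x)))"
      using lborel_integral_real_affine[of 1 "\<lambda>t. G t * cis (\<kappa> * x * t)" "\<delta> x"] by (simp add: add.commute)
    ultimately have I: "?I = - (LINT t|lborel. G (t + \<delta> x) * cis (\<kappa> * x * t))" by simp
    have "2 * ?I = ?I - (LINT t|lborel. G (t + \<delta> x) * cis (\<kappa> * x * t))" using I by simp
    also have "\<dots> = (LINT t|lborel. G t * cis (\<kappa> * x * t) - G (t + \<delta> x) * cis (\<kappa> * x * t))"
      by (rule Bochner_Integration.integral_diff[symmetric]) (intro int_cis int_G int_shift)+
    finally have "norm (2 * ?I) \<le> (LINT t|lborel. norm (G t * cis (\<kappa> * x * t) - G (t + \<delta> x) * cis (\<kappa> * x * t)))"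
      by (simp only: integral_norm_bound)
    also have "\<dots> = (LINT t|lborel. norm (G t - G (t + \<delta> x)))"
      by (simp add: left_diff_distrib[symmetric] norm_mult)
    finally have "2 * norm ?I \<le> (LINT t|lborel. norm (G t - G (t + \<delta> x)))" by (simp add: norm_mult)
    then show ?case using norm_ge_zero[of ?I] by linarith
  qed
  then have "((\<lambda>x. LINT t|lborel. G t * cis (\<kappa> * x * t)) \<longlongrightarrow> 0) at_top"
    by (rule Lim_null_comparison[OF _ lim])
  then show ?thesis by (simp add: set_lebesgue_integral_def G_def mult_ac)
qed

lemma isCont_F_kernel: "t > 0 \<Longrightarrow> isCont (F_kernel \<nu>) t"
  unfolding F_kernel_def using cosh_real_pos[of "t / 2"] by (intro continuous_intros) auto

lemma F_exponent_eq:
  "F_exponent \<nu> \<theta> = (LINT t:{0<..}|lborel. complex_of_real (F_kernel \<nu> t)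
      * (1 - cosh (complex_of_real t * (1 - \<theta> / (\<i> * complex_of_real pi)))))"
  unfolding F_exponent_def F_kernel_def zero_ereal_def interval_integral_to_infinity_eq ..

text \<open>For \<theta> = x + iy the argument of cosh is t(\<eta> + i x/pi) with \<eta> = 1 - y/pi.
  Both exponentials oscillate with frequency proportional to x and vanish in the limit, so only the
  constant 1 contributes. The strip is exactly |\<eta>| < 1 - \<nu>, where the kernel beats
  exp(|\<eta>| t).\<close>

lemma tendsto_F_exponent:
  assumes "0 < \<nu>" "\<nu> < 1" "pi * \<nu> < y" "y < 2 * pi - pi * \<nu>"
  shows "((\<lambda>x. F_exponent \<nu> (Complex x y)) \<longlongrightarrow> complex_of_real (LINT t:{0<..}|lborel. F_kernel \<nu> t)) at_top"
proof -
  define \<eta> where "\<eta> = 1 - y / pi"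
  \<comment> \<open>c = 0, 1, -1 gives the constant and the two exponentials of cosh.\<close>
  define g where "g c t = complex_of_real (F_kernel \<nu> t * exp (c * \<eta> * t))" for c t :: real
  have \<eta>: "\<bar>\<eta>\<bar> < 1 - \<nu>" using assms by (auto simp: \<eta>_def abs_if field_simps)
  have bound: "norm (g c t) \<le> 2 * \<nu> * exp (- (1 - \<nu> - \<bar>c * \<eta>\<bar>) * t)" if "t > 0" for c t
  proof -
    have "norm (g c t) = - F_kernel \<nu> t * exp (c * \<eta> * t)"
      using F_kernel_bounds(1)[OF assms(1,2) that] by (simp add: g_def norm_mult abs_if)
    also have "\<dots> \<le> (2 * \<nu> * exp (- (1 - \<nu>) * t)) * exp (\<bar>c * \<eta>\<bar> * t)"
      using F_kernel_bounds[OF assms(1,2) that] that assms by (intro mult_mono) (auto intro: mult_right_mono)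
    also have "\<dots> = 2 * \<nu> * exp (- (1 - \<nu> - \<bar>c * \<eta>\<bar>) * t)"
      by (simp add: exp_add[symmetric] algebra_simps)
    finally show ?thesis .
  qed
  have meas [measurable]: "g c \<in> borel_measurable borel" for c unfolding g_def by measurable
  have RL: "((\<lambda>x. LINT t:{0<..}|lborel. g c t * cis (c / pi * x * t)) \<longlongrightarrow> 0) at_top" if "\<bar>c\<bar> = 1" for c
  proof (rule Riemann_Lebesgue_greaterThan[where M = "2 * \<nu>" and \<epsilon> = "1 - \<nu> - \<bar>c * \<eta>\<bar>"])
    show "isCont (g c) t" if "t > 0" for t
      unfolding g_def using isCont_F_kernel[OF that] by (intro continuous_intros) auto
    show "norm (g c t) \<le> 2 * \<nu> * exp (- (1 - \<nu> - \<bar>c * \<eta>\<bar>) * t)" if "t > 0" for t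
      using that by (rule bound)
    show "0 < 1 - \<nu> - \<bar>c * \<eta>\<bar>" using \<eta> that by (simp add: abs_mult)
  qed (use that in auto)
  have intg: "set_integrable lborel {0<..} (\<lambda>t. g c t * cis (k * t))" if "\<bar>c\<bar> \<le> 1" for c k
    unfolding set_integrable_def
  proof (rule Bochner_Integration.integrable_bound)
    have "\<bar>c * \<eta>\<bar> \<le> 1 * \<bar>\<eta>\<bar>" unfolding abs_mult using that by (intro mult_right_mono) auto
    then show "integrable lborel (\<lambda>t. indicator {0<..} t *\<^sub>R (2 * \<nu> * exp (- (1 - \<nu> - \<bar>c * \<eta>\<bar>) * t)))"
      using \<eta> by (intro integrable_exp_greaterThan) linarith
    show "AE t in lborel. norm (indicator {0<..} t *\<^sub>R (g c t * cis (k * t)))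
        \<le> norm (indicator {0<..} t *\<^sub>R (2 * \<nu> * exp (- (1 - \<nu> - \<bar>c * \<eta>\<bar>) * t)))"
      using bound[of _ c] assms(1) by (intro AE_I2) (auto simp: indicator_def norm_mult)
    have [measurable]: "(\<lambda>t. cis (k * t)) \<in> borel_measurable borel"
      by (intro borel_measurable_continuous_onI continuous_intros)
    show "(\<lambda>t. indicator {0<..} t *\<^sub>R (g c t * cis (k * t))) \<in> borel_measurable lborel" by measurable
  qed
  have eq: "F_exponent \<nu> (Complex x y) = complex_of_real (LINT t:{0<..}|lborel. F_kernel \<nu> t)
      - 1 / 2 * (LINT t:{0<..}|lborel. g 1 t * cis (1 / pi * x * t))
      - 1 / 2 * (LINT t:{0<..}|lborel. g (- 1) t * cis (- 1 / pi * x * t))" for x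
  proof -
    have arg: "1 - Complex x y / (\<i> * complex_of_real pi) = complex_of_real \<eta> + \<i> * complex_of_real (x / pi)"
      by (simp add: \<eta>_def Complex_eq field_simps)
    have "F_exponent \<nu> (Complex x y) = (LINT t:{0<..}|lborel. g 0 t * cis (0 * t)
       - 1 / 2 * (g 1 t * cis (1 / pi * x * t)) - 1 / 2 * (g (- 1) t * cis (- 1 / pi * x * t)))"
      unfolding F_exponent_eq arg
    proof (intro set_lebesgue_integral_cong allI impI)
      fix t :: real
      have e: "exp (complex_of_real t * (complex_of_real \<eta> + \<i> * complex_of_real (x / pi)))
          = complex_of_real (exp (\<eta> * t)) * cis (1 / pi * x * t)"
        by (simp add: cis_conv_exp exp_of_real[symmetric] exp_add[symmetric] algebra_simps)
      have e': "exp (- (complex_of_real t * (complex_of_real \<eta> + \<i> * complex_of_real (x / pi))))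
          = complex_of_real (exp (- \<eta> * t)) * cis (- 1 / pi * x * t)"
        by (simp add: cis_conv_exp exp_of_real[symmetric] exp_add[symmetric] algebra_simps)
      show "complex_of_real (F_kernel \<nu> t) * (1 - cosh (complex_of_real t * (complex_of_real \<eta> + \<i> * complex_of_real (x / pi))))
        = g 0 t * cis (0 * t) - 1 / 2 * (g 1 t * cis (1 / pi * x * t)) - 1 / 2 * (g (- 1) t * cis (- 1 / pi * x * t))"
        unfolding cosh_field_def e e' by (simp add: g_def algebra_simps add_divide_distrib)
    qed simp
    also have "\<dots> = (LINT t:{0<..}|lborel. g 0 t * cis (0 * t)) - 1 / 2 * (LINT t:{0<..}|lborel. g 1 t * cis (1 / pi * x * t))
       - 1 / 2 * (LINT t:{0<..}|lborel. g (- 1) t * cis (- 1 / pi * x * t))"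
      using intg[of 0 0] intg[of 1 "1 / pi * x"] intg[of "- 1" "- 1 / pi * x"]
      by (subst set_integral_diff set_integral_mult_right; (intro set_integral_diff set_integrable_mult_right)?; simp)+
    also have "(LINT t:{0<..}|lborel. g 0 t * cis (0 * t)) = complex_of_real (LINT t:{0<..}|lborel. F_kernel \<nu> t)"
      by (simp add: g_def set_integral_complex_of_real)
    finally show ?thesis .
  qed
  have "((\<lambda>x. complex_of_real (LINT t:{0<..}|lborel. F_kernel \<nu> t)
      - 1 / 2 * (LINT t:{0<..}|lborel. g 1 t * cis (1 / pi * x * t))
      - 1 / 2 * (LINT t:{0<..}|lborel. g (- 1) t * cis (- 1 / pi * x * t)))
     \<longlongrightarrow> complex_of_real (LINT t:{0<..}|lborel. F_kernel \<nu> t) - 1 / 2 * 0 - 1 / 2 * 0) at_top"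
    by (intro tendsto_intros RL) auto
  then show ?thesis unfolding eq by simp
qed

text \<open>The limit of the exponent is the same on all horizontal lines of the strip, so one
  \<open>N\<close> serves them all; the line Im \<theta> = pi already determines it.\<close>

lemma F_norm_eq:
  assumes "0 < \<nu>" "\<nu> < 1"
  shows "F_norm \<nu> = exp (- complex_of_real (LINT t:{0<..}|lborel. F_kernel \<nu> t))"
proof -
  define I where "I = complex_of_real (LINT t:{0<..}|lborel. F_kernel \<nu> t)"
  have lim: "((\<lambda>x. N * exp (F_exponent \<nu> (Complex x y))) \<longlongrightarrow> N * exp I) at_top"
    if "pi * \<nu> < y" "y < 2 * pi - pi * \<nu>" for N y
    unfolding I_def using tendsto_F_exponent[OF assms that] by (intro tendsto_intros)
  have pi_in: "pi * \<nu> < pi" "pi < 2 * pi - pi * \<nu>" using assms by auto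
  show ?thesis
    unfolding F_norm_def I_def[symmetric]
  proof (rule the_equality)
    show "\<forall>y. pi * \<nu> < y \<and> y < 2 * pi - pi * \<nu> \<longrightarrow> ((\<lambda>x. exp (- I) * exp (F_exponent \<nu> (Complex x y))) \<longlongrightarrow> 1) at_top"
      using lim[of _ "exp (- I)"] by (simp add: exp_minus)
    fix N assume "\<forall>y. pi * \<nu> < y \<and> y < 2 * pi - pi * \<nu> \<longrightarrow> ((\<lambda>x. N * exp (F_exponent \<nu> (Complex x y))) \<longlongrightarrow> 1) at_top"
    then have "((\<lambda>x. N * exp (F_exponent \<nu> (Complex x pi))) \<longlongrightarrow> 1) at_top" using pi_in by blast
    then have "N * exp I = 1" using lim[OF pi_in, of N] tendsto_unique by (metis trivial_limit_at_top_linorder)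
    then show "N = exp (- I)" by (simp add: exp_minus field_simps)
  qed
qed

text \<open>cos(pi \<nu>/2) = sin(pi \<nu>) / (2 sin(pi \<nu>/2)) produces the prefactor of
  \<open>Z_phi\<close>. Since 1/(1 + \<nu>) = \<beta>^2/(8 pi \<nu>), this is the known formula for
  1/F(i pi).\<close>

lemma F_two_particle_i_pi:
  assumes "0 < \<nu>" "\<nu> < 1"
  shows "1 / F_two_particle \<nu> (\<i> * complex_of_real pi) =
    complex_of_real (Z_phi \<nu> / (1 + \<nu>) * (sin (pi * \<nu>) / (pi * \<nu>)))"
proof -
  have "\<i> * complex_of_real pi \<in> F_strip \<nu>" using assms by (simp add: F_strip_def)
  moreover have "F_exponent \<nu> (\<i> * complex_of_real pi) = 0"
    unfolding F_exponent_eq by (simp add: set_lebesgue_integral_def)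
  ultimately have "1 / F_two_particle \<nu> (\<i> * complex_of_real pi) =
      complex_of_real (exp (LINT t:{0<..}|lborel. F_kernel \<nu> t))"
    by (simp add: F_two_particle_def F_norm_eq[OF assms] exp_minus exp_of_real divide_inverse)
  also have "exp (LINT t:{0<..}|lborel. F_kernel \<nu> t) = Z_phi \<nu> / (1 + \<nu>) * (sin (pi * \<nu>) / (pi * \<nu>))"
  proof -
    have s: "sin (pi * \<nu> / 2) > 0" using assms by (intro sin_gt_zero) auto
    have "sin (pi * \<nu>) = 2 * sin (pi * \<nu> / 2) * cos (pi * \<nu> / 2)" using sin_double[of "pi * \<nu> / 2"] by simp
    then show ?thesis
      unfolding exp_integral_F_kernel[OF assms] Z_phi_def using s assms by (simp add: divide_simps)
  qed
  finally show ?thesis .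
qed

lemma Z_phi_pos:
  assumes "0 < \<nu>" "\<nu> < 1"
  shows "Z_phi \<nu> > 0"
proof -
  have "sin (pi / 2 * \<nu>) > 0" using assms by (intro sin_gt_zero) auto
  then show ?thesis unfolding Z_phi_def using assms by (intro mult_pos_pos divide_pos_pos) auto
qed

section \<open>The trace of the energy momentum tensor\<close>

text \<open>The points where some sinh vanishes form a closed set with dense complement, so equality
  at all other points is equality of meromorphic functions.\<close>

theorem mainTheorem2:
  fixes \<beta> \<nu> m \<alpha> :: real and n :: nat and \<theta> :: "nat \<Rightarrow> complex"
  assumes "0 < \<beta>\<^sup>2" and "\<beta>\<^sup>2 < 4 * pi"
    and "\<nu> = coupling_nu \<beta>"
    and "m > 0"
    and "\<alpha> = m\<^sup>2 * (pi * \<nu> / sin (pi * \<nu>))"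
    and "\<And>i j. 1 \<le> i \<Longrightarrow> i < j \<Longrightarrow> j \<le> n \<Longrightarrow> sinh (\<theta> i - \<theta> j) \<noteq> 0"
  shows "ff_trace \<beta> m n \<theta> =
    - 2 * complex_of_real (\<alpha> / \<beta>\<^sup>2 * (1 - \<beta>\<^sup>2 / (8 * pi))) * (ff_cos \<beta> n \<theta> - ff_identity n \<theta>)"
proof (cases "n = 0")
  case True
  then show ?thesis by (simp add: ff_trace_def ff_cos_def ff_exp_def ff_identity_def)
next
  case False
  define s where "s = sin (pi * \<nu>)"
  define s2 where "s2 = sin (pi * \<nu> / 2)"
  define x where "x = (\<lambda>i. exp (\<theta> i))"
  define a where "a = 2 * \<i> * complex_of_real s"
  define q where "q = exp (\<i> * complex_of_real (pi * \<nu>))"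
  define K where "K = exp_sum a x {1..n} q"
  define \<Phi> where "\<Phi> = (\<Prod>j=1..n. \<Prod>i=1..<j. F_two_particle \<nu> (\<theta> i - \<theta> j))"
  have b: "8 * pi - \<beta>\<^sup>2 > 0" "\<beta> \<noteq> 0"
    using assms(1,2) pi_gt_zero by (linarith, auto)
  have \<nu>: "0 < \<nu>" "\<nu> < 1" using assms(1,2) b by (auto simp: assms(3) coupling_nu_def field_simps)
  have \<beta>: "\<beta>\<^sup>2 = 8 * pi * \<nu> / (1 + \<nu>)"
    using b by (simp add: assms(3) coupling_nu_def field_simps)
  have s: "s > 0" "s2 > 0" unfolding s_def s2_def using \<nu> by (auto intro!: sin_gt_zero)
  have gen: "generic x {1..n}"
  proof -
    have "(x i)\<^sup>2 \<noteq> (x j)\<^sup>2" if "i \<in> {1..n}" "j \<in> {1..n}" "i < j" for i j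
    proof
      assume *: "(x i)\<^sup>2 = (x j)\<^sup>2"
      have "2 * sinh (\<theta> i - \<theta> j) * (x i * x j) = (x i)\<^sup>2 - (x j)\<^sup>2"
        by (simp add: x_def sinh_field_def exp_diff field_simps power2_eq_square)
      then show False using assms(6)[of i j] that * by (simp add: x_def)
    qed
    moreover have "i < j \<or> j < i" if "i \<noteq> j" for i j :: nat using that by auto
    ultimately show ?thesis unfolding generic_def by (metis exp_not_eq_zero x_def)
  qed
  have q: "q \<noteq> 0" "q - 1 / q = a"
  proof -
    have "1 / q = exp (- (\<i> * complex_of_real (pi * \<nu>)))" by (simp add: q_def exp_minus inverse_eq_divide)
    then show "q - 1 / q = a"
      by (simp add: q_def a_def s_def sin_of_real[symmetric] sin_exp_eq field_simps)
  qed (simp add: q_def)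
  have K1: "K_function \<nu> (p_exp \<beta> \<beta>) n \<theta> = K"
    using K_function_p_exp[of \<beta> \<beta> "pi * \<nu>" \<nu> n \<theta>] b by (simp add: assms(3) K_def q_def a_def s_def x_def)
  have K2: "K_function \<nu> (p_exp \<beta> (- \<beta>)) n \<theta> = (- 1) ^ n * K"
  proof -
    have "K_function \<nu> (p_exp \<beta> (- \<beta>)) n \<theta> = exp_sum a x {1..n} (1 / q)"
      using K_function_p_exp[of \<beta> "- \<beta>" "- (pi * \<nu>)" \<nu> n \<theta>] b
      by (simp add: assms(3) K_def q_def a_def s_def x_def exp_minus inverse_eq_divide)
    also have "\<dots> = (- 1) ^ n * exp_sum a x {1..n} (- 1 / q)"
      using exp_sum_uminus[of a x "{1..n}" "- (1 / q)"] by simp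
    also have "exp_sum a x {1..n} (- 1 / q) = a * (\<Sum>i=1..n. x i) * inv_sum a x {1..n}"
      using False gen q by (intro exp_sum_eq_inv_sum) (auto simp: field_simps)
    also have "\<dots> = K"
      unfolding K_def using False gen q by (intro exp_sum_eq_inv_sum[symmetric]) auto
    finally show ?thesis .
  qed
  have cos: "ff_cos \<beta> n \<theta> = (1 + (- 1) ^ n) / 2 * (N_exp \<beta> n * K * \<Phi>)"
    using False by (simp add: ff_cos_def ff_exp_def ff_general_def assms(3)[symmetric] K1 K2 \<Phi>_def field_simps)
  show ?thesis
  proof (cases "even n")
    case odd: False
    then show ?thesis using False by (simp add: ff_trace_def cos ff_identity_def)
  next
    case True
    then obtain k where k: "n = 2 * Suc k" using False by (metis dvdE not0_implies_Suc mult_0_right)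
    define V where "V = 1 / F_two_particle \<nu> (\<i> * complex_of_real pi)"
    have V: "V = complex_of_real (Z_phi \<nu> / (1 + \<nu>) * (s / (pi * \<nu>)))"
      unfolding V_def s_def using \<nu> by (rule F_two_particle_i_pi)
    have Z: "Z_phi \<nu> > 0" using \<nu> by (rule Z_phi_pos)
    have base: "(sqrt (Z_phi \<nu>) * (\<beta> / (2 * pi * \<nu>)))\<^sup>2 = 2 * Z_phi \<nu> / ((1 + \<nu>) * pi * \<nu>)"
    proof -
      have "(sqrt (Z_phi \<nu>) * (\<beta> / (2 * pi * \<nu>)))\<^sup>2 = Z_phi \<nu> * (\<beta>\<^sup>2 / (2 * pi * \<nu>)\<^sup>2)"
        using Z by (simp add: power_mult_distrib power_divide)
      also have "\<beta>\<^sup>2 / (2 * pi * \<nu>)\<^sup>2 = 2 / ((1 + \<nu>) * pi * \<nu>)"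
        unfolding \<beta> using \<nu> by (simp add: divide_simps power2_eq_square)
      finally show ?thesis by simp
    qed
    have N: "N_exp \<beta> n = complex_of_real ((2 * Z_phi \<nu> / ((1 + \<nu>) * pi * \<nu>)) ^ Suc k)"
      unfolding N_exp_def k power_mult assms(3)[symmetric] base ..
    \<comment> \<open>The factor per pair of particles in the trace normalization equals the square
      of the factor per particle for the exponentials.\<close>
    have base2: "2 / (complex_of_real s * F_two_particle \<nu> (\<i> * complex_of_real pi))
      = complex_of_real (2 * Z_phi \<nu> / ((1 + \<nu>) * pi * \<nu>))"
    proof -
      have "2 / (complex_of_real s * F_two_particle \<nu> (\<i> * complex_of_real pi)) = 2 / complex_of_real s * V"
        by (simp add: V_def)
      then show ?thesis unfolding V using s by (simp add: field_simps)
    qed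
    \<comment> \<open>\<open>N_trace_2\<close> contains one more such factor, which raises the
      exponent from k to k + 1 = n/2.\<close>
    have Nt: "N_trace \<nu> m n = \<i> * complex_of_real (m\<^sup>2) / (4 * complex_of_real s2) * N_exp \<beta> n"
    proof -
      have "(n - 2) div 2 = k" using k by simp
      moreover have "N_trace_2 \<nu> m = \<i> * complex_of_real (m\<^sup>2) / (4 * complex_of_real s2) *
          (2 / (complex_of_real s * F_two_particle \<nu> (\<i> * complex_of_real pi)))"
        by (simp add: N_trace_2_def s_def s2_def)
      ultimately show ?thesis
        unfolding N_trace_def N s_def[symmetric] base2 by simp
    qed
    \<comment> \<open>The ratio of the two K-functions is -2 sin(pi \<nu>/2)/a with a = 2i sin(pi
      \<nu>).\<close>
    have Kt: "complex_of_real s * K_function \<nu> (p_trace \<nu>) n \<theta> = \<i> * complex_of_real s2 * K"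
    proof -
      have "K = a * (\<Sum>i=1..n. x i) * inv_sum a x {1..n}"
        unfolding K_def using False gen q by (intro exp_sum_eq_inv_sum) auto
      moreover have "K_function \<nu> (p_trace \<nu>) n \<theta> = - 2 * complex_of_real s2 * (\<Sum>i=1..n. x i) * inv_sum a x {1..n}"
        using K_function_p_trace[of n \<theta> \<nu>] False gen by (simp add: a_def x_def s_def s2_def)
      ultimately show ?thesis by (simp add: a_def)
    qed
    have "ff_trace \<beta> m n \<theta> = N_trace \<nu> m n * K_function \<nu> (p_trace \<nu>) n \<theta> * \<Phi>"
      using True k by (simp add: ff_trace_def ff_general_def assms(3)[symmetric] \<Phi>_def)
    also have "K_function \<nu> (p_trace \<nu>) n \<theta> = \<i> * complex_of_real s2 / complex_of_real s * K"
      using Kt s by (simp add: field_simps)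
    also have "N_trace \<nu> m n * (\<i> * complex_of_real s2 / complex_of_real s * K) * \<Phi>
        = - complex_of_real (m\<^sup>2 / (4 * s)) * (N_exp \<beta> n * K * \<Phi>)"
      unfolding Nt using s by (simp add: field_simps)
    also have "m\<^sup>2 / (4 * s) = 2 * (\<alpha> / \<beta>\<^sup>2 * (1 - \<beta>\<^sup>2 / (8 * pi)))"
    proof -
      have b1: "1 - \<beta>\<^sup>2 / (8 * pi) = 1 / (1 + \<nu>)"
        unfolding \<beta> using \<nu> by (simp add: divide_simps)
      have b2: "\<alpha> / \<beta>\<^sup>2 = m\<^sup>2 * (1 + \<nu>) / (8 * s)"
        unfolding assms(5) \<beta> s_def[symmetric] using \<nu> s by (simp add: divide_simps)
      show ?thesis unfolding b1 b2 using \<nu> s by (simp add: divide_simps)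
    qed
    finally show ?thesis using True False by (simp add: cos ff_identity_def)
  qed
qed

end
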